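(* The ring $\mathbb Z[x]$ is regularly bi-interpretable with the ring $\mathbb Z$.
   Context: A regular interpretation $(\Gamma,\phi)$ of $\mathbb A$ in $\mathbb B$ is a code of $L(\mathbb B)$-formulas with parameters $\bar y$ defining a subset of $B^n$, an equivalence relation on it and the operations of $\mathbb A$ on the quotient, together with a formula $\phi(\bar y)$ with $\phi(\mathbb B)\ne\emptyset$, such that the resulting structure $\Gamma(\mathbb B,\bar p)\cong\mathbb A$ for every $\bar p\in\phi(\mathbb B)$; a coordinate map is a surjection from the defined subset onto $A$ inducing such an isomorphism. $\mathbb A$ and $\mathbb B$ are regularly bi-interpretable if there are regular interpretations $(\Gamma,\phi)$ of $\mathbb A$ in $\mathbb B$ and $(\Delta,\psi)$ of $\mathbb B$ in $\mathbb A$ and formulas $\theta_{\mathbb A},\theta_{\mathbb B}$ such that for every admissible parameter tuple $\bar r_0$ of the composite interpretation $\Gamma\circ\Delta$ of $\mathbb A$ in $\mathbb A$, $\theta_{\mathbb A}(\bar u,x,\bar r_0)$ defines a coordinate map $\Gamma\circ\Delta(\mathbb A,\bar r_0)\to\mathbb A$, and symmetrically for $\Delta\circ\Gamma$ and $\theta_{\mathbb B}$. *)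

theory Defs
  imports "HOL-Algebra.Ring" "HOL-Computational_Algebra.Polynomial"
begin

section \<open>First-order logic over the language of rings\<close>

text \<open>
  Structures for the language \<open>{0, 1, +, \<cdot>}\<close> are the \<open>ring\<close> records of
  \<open>HOL-Algebra\<close>, used as bare records: no ring axioms are implied. (A quotient defined by
  formulas is a priori only such a structure.)
\<close>

definition class_ring :: "'a::comm_ring_1 ring" where
  "class_ring = \<lparr>carrier = UNIV, monoid.mult = (*), one = 1, zero = 0, add = (+)\<rparr>"

definition struct_iso :: "'a ring \<Rightarrow> 'b ring \<Rightarrow> ('a \<Rightarrow> 'b) set" where
  "struct_iso R S =
     {h \<in> ring_hom R S. h \<zero>\<^bsub>R\<^esub> = \<zero>\<^bsub>S\<^esub> \<and> bij_betw h (carrier R) (carrier S)}"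

text \<open>
  Variables are de Bruijn indices into an environment list. Hence a formula with free
  variables among the first \<open>N\<close> indices (\<open>wf_fm N\<close>) defines an \<open>N\<close>-ary relation, and
  \<open>sat M (u @ p) \<phi>\<close> reads \<open>M \<Turnstile> \<phi>(u, p)\<close>.
\<close>

datatype tm = Var nat | TZero | TOne | TAdd tm tm | TMul tm tm

datatype fm = Eq tm tm | Neg fm | Conj fm fm | Ex fm

fun tm_val :: "'a ring \<Rightarrow> 'a list \<Rightarrow> tm \<Rightarrow> 'a" where
  "tm_val M e (Var i) = e ! i"
| "tm_val M e TZero = \<zero>\<^bsub>M\<^esub>"
| "tm_val M e TOne = \<one>\<^bsub>M\<^esub>"
| "tm_val M e (TAdd s t) = tm_val M e s \<oplus>\<^bsub>M\<^esub> tm_val M e t"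
| "tm_val M e (TMul s t) = tm_val M e s \<otimes>\<^bsub>M\<^esub> tm_val M e t"

fun sat :: "'a ring \<Rightarrow> 'a list \<Rightarrow> fm \<Rightarrow> bool" where
  "sat M e (Eq s t) \<longleftrightarrow> tm_val M e s = tm_val M e t"
| "sat M e (Neg \<phi>) \<longleftrightarrow> \<not> sat M e \<phi>"
| "sat M e (Conj \<phi> \<psi>) \<longleftrightarrow> sat M e \<phi> \<and> sat M e \<psi>"
| "sat M e (Ex \<phi>) \<longleftrightarrow> (\<exists>a\<in>carrier M. sat M (a # e) \<phi>)"

fun wf_tm :: "nat \<Rightarrow> tm \<Rightarrow> bool" where
  "wf_tm N (Var i) \<longleftrightarrow> i < N"
| "wf_tm N TZero \<longleftrightarrow> True"
| "wf_tm N TOne \<longleftrightarrow> True"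
| "wf_tm N (TAdd s t) \<longleftrightarrow> wf_tm N s \<and> wf_tm N t"
| "wf_tm N (TMul s t) \<longleftrightarrow> wf_tm N s \<and> wf_tm N t"

fun wf_fm :: "nat \<Rightarrow> fm \<Rightarrow> bool" where
  "wf_fm N (Eq s t) \<longleftrightarrow> wf_tm N s \<and> wf_tm N t"
| "wf_fm N (Neg \<phi>) \<longleftrightarrow> wf_fm N \<phi>"
| "wf_fm N (Conj \<phi> \<psi>) \<longleftrightarrow> wf_fm N \<phi> \<and> wf_fm N \<psi>"
| "wf_fm N (Ex \<phi>) \<longleftrightarrow> wf_fm (Suc N) \<phi>"

definition tuples :: "'a ring \<Rightarrow> nat \<Rightarrow> 'a list set" where
  "tuples M n = {u. length u = n \<and> set u \<subseteq> carrier M}"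

definition solutions :: "'a ring \<Rightarrow> nat \<Rightarrow> fm \<Rightarrow> 'a list set" where
  "solutions M n \<phi> = {u \<in> tuples M n. sat M u \<phi>}"


section \<open>Codes and the structures they define\<close>

text \<open>
  With \<open>n = cdim\<close> and \<open>k = cpar\<close>, the environments of the formulas of a code consist of one
  (\<open>cdom\<close>, \<open>czero\<close>, \<open>cone\<close>), two (\<open>ceq\<close>) or three (\<open>cadd\<close>, \<open>cmul\<close>) consecutive \<open>n\<close>-tuples
  followed by the \<open>k\<close> parameters. An operation is given by its graph, the value being the
  last of the \<open>n\<close>-tuples.
\<close>

record code =
  cdim :: nat
  cpar :: nat
  cdom :: fm
  ceq :: fm
  czero :: fm
  cone :: fm
  cadd :: fm
  cmul :: fm

definition wf_code :: "code \<Rightarrow> bool" where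
  "wf_code \<Gamma> \<longleftrightarrow>
     wf_fm (cdim \<Gamma> + cpar \<Gamma>) (cdom \<Gamma>) \<and>
     wf_fm (2 * cdim \<Gamma> + cpar \<Gamma>) (ceq \<Gamma>) \<and>
     wf_fm (cdim \<Gamma> + cpar \<Gamma>) (czero \<Gamma>) \<and>
     wf_fm (cdim \<Gamma> + cpar \<Gamma>) (cone \<Gamma>) \<and>
     wf_fm (3 * cdim \<Gamma> + cpar \<Gamma>) (cadd \<Gamma>) \<and>
     wf_fm (3 * cdim \<Gamma> + cpar \<Gamma>) (cmul \<Gamma>)"

definition dom_set :: "code \<Rightarrow> 'b ring \<Rightarrow> 'b list \<Rightarrow> 'b list set" where
  "dom_set \<Gamma> M p = {u \<in> tuples M (cdim \<Gamma>). sat M (u @ p) (cdom \<Gamma>)}"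

definition eq_rel :: "code \<Rightarrow> 'b ring \<Rightarrow> 'b list \<Rightarrow> ('b list \<times> 'b list) set" where
  "eq_rel \<Gamma> M p =
     {(u, v) \<in> dom_set \<Gamma> M p \<times> dom_set \<Gamma> M p. sat M (u @ v @ p) (ceq \<Gamma>)}"

definition const_val :: "fm \<Rightarrow> code \<Rightarrow> 'b ring \<Rightarrow> 'b list \<Rightarrow> 'b list set" where
  "const_val \<phi> \<Gamma> M p = {w \<in> dom_set \<Gamma> M p. sat M (w @ p) \<phi>}"

definition op_val ::
  "fm \<Rightarrow> code \<Rightarrow> 'b ring \<Rightarrow> 'b list \<Rightarrow> 'b list \<Rightarrow> 'b list \<Rightarrow> 'b list set" where
  "op_val \<phi> \<Gamma> M p u v = {w \<in> dom_set \<Gamma> M p. sat M (u @ v @ w @ p) \<phi>}"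

text \<open>
  \<open>code_defines \<Gamma> M p\<close>: the formulas of \<open>\<Gamma>\<close> with parameters \<open>p\<close> do define an equivalence
  relation and operations on the quotient; \<open>defined_struct \<Gamma> M p\<close> is then \<open>\<Gamma>(M, p)\<close>.
\<close>

definition op_defines :: "fm \<Rightarrow> code \<Rightarrow> 'b ring \<Rightarrow> 'b list \<Rightarrow> bool" where
  "op_defines \<phi> \<Gamma> M p \<longleftrightarrow>
     op_val \<phi> \<Gamma> M p respects2 eq_rel \<Gamma> M p \<and>
     (\<forall>u\<in>dom_set \<Gamma> M p. \<forall>v\<in>dom_set \<Gamma> M p.
        op_val \<phi> \<Gamma> M p u v \<in> dom_set \<Gamma> M p // eq_rel \<Gamma> M p)"

definition code_defines :: "code \<Rightarrow> 'b ring \<Rightarrow> 'b list \<Rightarrow> bool" where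
  "code_defines \<Gamma> M p \<longleftrightarrow>
     equiv (dom_set \<Gamma> M p) (eq_rel \<Gamma> M p) \<and>
     const_val (czero \<Gamma>) \<Gamma> M p \<in> dom_set \<Gamma> M p // eq_rel \<Gamma> M p \<and>
     const_val (cone \<Gamma>) \<Gamma> M p \<in> dom_set \<Gamma> M p // eq_rel \<Gamma> M p \<and>
     op_defines (cadd \<Gamma>) \<Gamma> M p \<and>
     op_defines (cmul \<Gamma>) \<Gamma> M p"

definition defined_struct :: "code \<Rightarrow> 'b ring \<Rightarrow> 'b list \<Rightarrow> 'b list set ring" where
  "defined_struct \<Gamma> M p =
     \<lparr>carrier = dom_set \<Gamma> M p // eq_rel \<Gamma> M p,
      monoid.mult = (\<lambda>X Y. \<Union>u\<in>X. \<Union>v\<in>Y. op_val (cmul \<Gamma>) \<Gamma> M p u v),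
      one = const_val (cone \<Gamma>) \<Gamma> M p,
      zero = const_val (czero \<Gamma>) \<Gamma> M p,
      add = (\<lambda>X Y. \<Union>u\<in>X. \<Union>v\<in>Y. op_val (cadd \<Gamma>) \<Gamma> M p u v)\<rparr>"

definition coordinate_map ::
  "code \<Rightarrow> 'b ring \<Rightarrow> 'b list \<Rightarrow> 'a ring \<Rightarrow> ('b list \<Rightarrow> 'a) \<Rightarrow> bool" where
  "coordinate_map \<Gamma> M p A \<mu> \<longleftrightarrow>
     code_defines \<Gamma> M p \<and> \<mu> ` dom_set \<Gamma> M p = carrier A \<and>
     (\<exists>h\<in>struct_iso (defined_struct \<Gamma> M p) A.
        \<forall>u\<in>dom_set \<Gamma> M p. \<mu> u = h (eq_rel \<Gamma> M p `` {u}))"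

definition regular_interpretation :: "code \<Rightarrow> fm \<Rightarrow> 'a ring \<Rightarrow> 'b ring \<Rightarrow> bool" where
  "regular_interpretation \<Gamma> \<phi> A B \<longleftrightarrow>
     wf_code \<Gamma> \<and> wf_fm (cpar \<Gamma>) \<phi> \<and> solutions B (cpar \<Gamma>) \<phi> \<noteq> {} \<and>
     (\<forall>p\<in>solutions B (cpar \<Gamma>) \<phi>.
        code_defines \<Gamma> B p \<and> struct_iso (defined_struct \<Gamma> B p) A \<noteq> {})"


section \<open>Translation of formulas along a code, and composition\<close>

text \<open>\<open>inst \<phi> vs\<close> is \<open>\<phi>\<close> with the variable \<open>vs ! i\<close> substituted for the variable \<open>i\<close>.\<close>

fun ren_tm :: "(nat \<Rightarrow> nat) \<Rightarrow> tm \<Rightarrow> tm" where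
  "ren_tm f (Var i) = Var (f i)"
| "ren_tm f TZero = TZero"
| "ren_tm f TOne = TOne"
| "ren_tm f (TAdd s t) = TAdd (ren_tm f s) (ren_tm f t)"
| "ren_tm f (TMul s t) = TMul (ren_tm f s) (ren_tm f t)"

fun ren_fm :: "(nat \<Rightarrow> nat) \<Rightarrow> fm \<Rightarrow> fm" where
  "ren_fm f (Eq s t) = Eq (ren_tm f s) (ren_tm f t)"
| "ren_fm f (Neg \<phi>) = Neg (ren_fm f \<phi>)"
| "ren_fm f (Conj \<phi> \<psi>) = Conj (ren_fm f \<phi>) (ren_fm f \<psi>)"
| "ren_fm f (Ex \<phi>) = Ex (ren_fm (case_nat 0 (\<lambda>i. Suc (f i))) \<phi>)"

definition inst :: "fm \<Rightarrow> nat list \<Rightarrow> fm" where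
  "inst \<phi> vs = ren_fm (\<lambda>i. vs ! i) \<phi>"

definition Exs :: "nat \<Rightarrow> fm \<Rightarrow> fm" where
  "Exs n \<phi> = (Ex ^^ n) \<phi>"

definition shift :: "nat \<Rightarrow> nat list \<Rightarrow> nat list" where
  "shift n vs = map (\<lambda>i. i + n) vs"

definition conjs :: "fm list \<Rightarrow> fm" where
  "conjs \<phi>s = foldr Conj \<phi>s (Eq TZero TZero)"

text \<open>
  In a translation along \<open>\<Delta>\<close>, the variable \<open>i\<close> becomes the block \<open>\<sigma> i\<close> of \<open>cdim \<Delta>\<close> variables,
  and \<open>\<pi>\<close> lists the variables that hold the parameters of \<open>\<Delta>\<close>.
  \<open>tr_tm \<Delta> \<sigma> \<pi> z t\<close> says that the block \<open>z\<close>, assumed to lie in the domain of \<open>\<Delta>\<close>,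
  represents the value of \<open>t\<close>. In \<open>tr_binop\<close>, \<open>F\<close> and \<open>G\<close> speak about the freshly bound
  blocks \<open>a\<close> and \<open>b\<close>.
\<close>

definition tr_binop :: "fm \<Rightarrow> code \<Rightarrow> nat list \<Rightarrow> nat list \<Rightarrow> fm \<Rightarrow> fm \<Rightarrow> fm" where
  "tr_binop \<phi> \<Delta> \<pi> z F G =
     (let n = cdim \<Delta>; a = [0..<n]; b = [n..<2 * n]; sh = shift (2 * n) in
      Exs (2 * n) (conjs
        [inst (cdom \<Delta>) (a @ sh \<pi>), inst (cdom \<Delta>) (b @ sh \<pi>), F, G,
         inst \<phi> (a @ b @ sh z @ sh \<pi>)]))"

fun tr_tm :: "code \<Rightarrow> (nat \<Rightarrow> nat list) \<Rightarrow> nat list \<Rightarrow> nat list \<Rightarrow> tm \<Rightarrow> fm" where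
  "tr_tm \<Delta> \<sigma> \<pi> z (Var i) = inst (ceq \<Delta>) (\<sigma> i @ z @ \<pi>)"
| "tr_tm \<Delta> \<sigma> \<pi> z TZero = inst (czero \<Delta>) (z @ \<pi>)"
| "tr_tm \<Delta> \<sigma> \<pi> z TOne = inst (cone \<Delta>) (z @ \<pi>)"
| "tr_tm \<Delta> \<sigma> \<pi> z (TAdd s t) =
     (let n = cdim \<Delta>; sh = shift (2 * n) in tr_binop (cadd \<Delta>) \<Delta> \<pi> z
        (tr_tm \<Delta> (\<lambda>i. sh (\<sigma> i)) (sh \<pi>) [0..<n] s)
        (tr_tm \<Delta> (\<lambda>i. sh (\<sigma> i)) (sh \<pi>) [n..<2 * n] t))"
| "tr_tm \<Delta> \<sigma> \<pi> z (TMul s t) =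
     (let n = cdim \<Delta>; sh = shift (2 * n) in tr_binop (cmul \<Delta>) \<Delta> \<pi> z
        (tr_tm \<Delta> (\<lambda>i. sh (\<sigma> i)) (sh \<pi>) [0..<n] s)
        (tr_tm \<Delta> (\<lambda>i. sh (\<sigma> i)) (sh \<pi>) [n..<2 * n] t))"

fun tr_fm :: "code \<Rightarrow> (nat \<Rightarrow> nat list) \<Rightarrow> nat list \<Rightarrow> fm \<Rightarrow> fm" where
  "tr_fm \<Delta> \<sigma> \<pi> (Eq s t) =
     (let n = cdim \<Delta>; sh = shift (2 * n) in tr_binop (ceq \<Delta>) \<Delta> \<pi> []
        (tr_tm \<Delta> (\<lambda>i. sh (\<sigma> i)) (sh \<pi>) [0..<n] s)
        (tr_tm \<Delta> (\<lambda>i. sh (\<sigma> i)) (sh \<pi>) [n..<2 * n] t))"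
| "tr_fm \<Delta> \<sigma> \<pi> (Neg \<phi>) = Neg (tr_fm \<Delta> \<sigma> \<pi> \<phi>)"
| "tr_fm \<Delta> \<sigma> \<pi> (Conj \<phi> \<psi>) = Conj (tr_fm \<Delta> \<sigma> \<pi> \<phi>) (tr_fm \<Delta> \<sigma> \<pi> \<psi>)"
| "tr_fm \<Delta> \<sigma> \<pi> (Ex \<phi>) =
     (let n = cdim \<Delta>; sh = shift n in
      Exs n (Conj
        (inst (cdom \<Delta>) ([0..<n] @ sh \<pi>))
        (tr_fm \<Delta> (case_nat [0..<n] (\<lambda>i. sh (\<sigma> i))) (sh \<pi>) \<phi>)))"

text \<open>
  \<open>translate \<Delta> N \<phi>\<close> is the \<open>\<Delta>\<close>-translation of a formula \<open>\<phi>(x\<^sub>0, \<dots>, x\<^sub>N\<^sub>-\<^sub>1)\<close>, with variables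
  ordered as \<open>N\<close> blocks followed by the parameters of \<open>\<Delta>\<close>; \<open>in_dom \<Delta> N l\<close> says that
  the first \<open>l\<close> of these blocks lie in the domain of \<open>\<Delta>\<close>.
\<close>

definition block :: "code \<Rightarrow> nat \<Rightarrow> nat list" where
  "block \<Delta> i = [i * cdim \<Delta>..<Suc i * cdim \<Delta>]"

definition par_vars :: "code \<Rightarrow> nat \<Rightarrow> nat list" where
  "par_vars \<Delta> N = [N * cdim \<Delta>..<N * cdim \<Delta> + cpar \<Delta>]"

definition translate :: "code \<Rightarrow> nat \<Rightarrow> fm \<Rightarrow> fm" where
  "translate \<Delta> N \<phi> = tr_fm \<Delta> (block \<Delta>) (par_vars \<Delta> N) \<phi>"

definition in_dom :: "code \<Rightarrow> nat \<Rightarrow> nat \<Rightarrow> fm" where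
  "in_dom \<Delta> N l =
     conjs (map (\<lambda>j. inst (cdom \<Delta>) (block \<Delta> j @ par_vars \<Delta> N)) [0..<l])"

text \<open>
  For \<open>\<Gamma>\<close> interpreting \<open>A\<close> in \<open>B\<close> and \<open>\<Delta>\<close> interpreting \<open>B\<close> in \<open>C\<close>, the code
  \<open>comp_code \<Gamma> \<Delta>\<close> interprets \<open>A\<close> in \<open>C\<close>. Its parameters are representatives of the
  parameters of \<open>\<Gamma>\<close> followed by the parameters of \<open>\<Delta>\<close>; \<open>comp_adm\<close> defines the
  admissible ones.
\<close>

definition comp_code :: "code \<Rightarrow> code \<Rightarrow> code" where
  "comp_code \<Gamma> \<Delta> =
     (let n = cdim \<Gamma>; k = cpar \<Gamma> in
      \<lparr>cdim = n * cdim \<Delta>,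
       cpar = k * cdim \<Delta> + cpar \<Delta>,
       cdom = Conj (in_dom \<Delta> (n + k) n) (translate \<Delta> (n + k) (cdom \<Gamma>)),
       ceq = translate \<Delta> (2 * n + k) (ceq \<Gamma>),
       czero = translate \<Delta> (n + k) (czero \<Gamma>),
       cone = translate \<Delta> (n + k) (cone \<Gamma>),
       cadd = translate \<Delta> (3 * n + k) (cadd \<Gamma>),
       cmul = translate \<Delta> (3 * n + k) (cmul \<Gamma>)\<rparr>)"

definition comp_adm :: "code \<Rightarrow> fm \<Rightarrow> code \<Rightarrow> fm \<Rightarrow> fm" where
  "comp_adm \<Gamma> \<phi> \<Delta> \<psi> =
     Conj (inst \<psi> (par_vars \<Delta> (cpar \<Gamma>)))
       (Conj (in_dom \<Delta> (cpar \<Gamma>) (cpar \<Gamma>)) (translate \<Delta> (cpar \<Gamma>) \<phi>))"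


section \<open>Regular bi-interpretability\<close>

text \<open>
  The formula \<open>\<theta>(u, x, r)\<close> defines, for all parameters \<open>r\<close> satisfying \<open>\<chi>\<close>, the graph of a
  coordinate map \<open>\<Lambda>(A, r) \<rightarrow> A\<close>.
\<close>

definition defines_coordinate_maps :: "fm \<Rightarrow> code \<Rightarrow> fm \<Rightarrow> 'a ring \<Rightarrow> bool" where
  "defines_coordinate_maps \<theta> \<Lambda> \<chi> A \<longleftrightarrow>
     wf_fm (cdim \<Lambda> + 1 + cpar \<Lambda>) \<theta> \<and>
     (\<forall>r\<in>solutions A (cpar \<Lambda>) \<chi>. \<exists>\<mu>. coordinate_map \<Lambda> A r A \<mu> \<and>
        (\<forall>u\<in>tuples A (cdim \<Lambda>). \<forall>x\<in>carrier A.
           sat A (u @ [x] @ r) \<theta> \<longleftrightarrow> u \<in> dom_set \<Lambda> A r \<and> x = \<mu> u))"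

definition regularly_bi_interpretable :: "'a ring \<Rightarrow> 'b ring \<Rightarrow> bool" where
  "regularly_bi_interpretable A B \<longleftrightarrow>
     (\<exists>\<Gamma> \<phi> \<Delta> \<psi> \<theta>\<^sub>A \<theta>\<^sub>B.
        regular_interpretation \<Gamma> \<phi> A B \<and>
        regular_interpretation \<Delta> \<psi> B A \<and>
        defines_coordinate_maps \<theta>\<^sub>A (comp_code \<Gamma> \<Delta>) (comp_adm \<Gamma> \<phi> \<Delta> \<psi>) A \<and>
        defines_coordinate_maps \<theta>\<^sub>B (comp_code \<Delta> \<Gamma>) (comp_adm \<Delta> \<psi> \<Gamma> \<phi>) B)"

end

theory Submission
  imports Defs "HOL-Number_Theory.Cong"
begin

text \<open>
  In \<open>\<int>\<close> the order is definable by sums of four squares, hence so are Goedel's beta function and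
  the relation \<open>f(n) = v\<close> for polynomials \<open>f\<close> given by codes of their coefficient sequences. Since
  integer polynomials are determined by their values at the integers, this evaluation relation
  alone yields the equality and the operations of \<open>\<int>[x]\<close>.

  In \<open>\<int>[x]\<close> the constants are definable through the Pell equation: if \<open>t\<close> has positive degree,
  the solutions of \<open>X\<^sup>2 - (t\<^sup>2 - 1) Y\<^sup>2 = 1\<close> satisfy \<open>Y \<equiv> n\<close> modulo \<open>t - 1\<close> for an integer \<open>n\<close>, every
  \<open>n\<close> occurs, and for \<open>deg t > deg c\<close> the congruence \<open>c \<equiv> n\<close> forces \<open>c = n\<close>. The interpretation of
  \<open>\<int>\<close> carries one parameter \<open>t\<close>, constrained to be \<open>\<plusminus>x + k\<close>; its formulas ignore it, but it makes the
  coordinate map \<open>f \<mapsto> f(t)\<close> definable: \<open>t - n\<close> has to divide \<open>f(t) - f(n)\<close> for all constants \<open>n\<close>.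
\<close>

section \<open>Formulas and coordinate maps\<close>

text \<open>Only the \<open>N\<close> possible free variables are compared, so the two environments
  may differ in length. Under a quantifier both grow by the same element, and
  \<open>case_nat\<close> keeps index 0 in place.\<close>

lemma sat_ren:
  "wf_fm N \<phi> \<Longrightarrow> (\<And>i. i < N \<Longrightarrow> e' ! i = e ! f i) \<Longrightarrow> sat M e (ren_fm f \<phi>) \<longleftrightarrow> sat M e' \<phi>"
proof (induction \<phi> arbitrary: N e e' f)
  case (Eq s t)
  have "wf_tm N u \<Longrightarrow> tm_val M e (ren_tm f u) = tm_val M e' u" for u
    using Eq.prems(2) by (induction u) auto
  with Eq.prems(1) show ?case by simp
next
  case (Ex \<phi>)
  have "sat M (a # e) (ren_fm (case_nat 0 (\<lambda>i. Suc (f i))) \<phi>) \<longleftrightarrow> sat M (a # e') \<phi>" for a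
    using Ex.prems by (intro Ex.IH[of "Suc N"]) (auto simp: nth_Cons split: nat.split)
  then show ?case by simp
next
  case (Conj \<phi> \<psi>)
  have "sat M e (ren_fm f \<phi>) \<longleftrightarrow> sat M e' \<phi>" "sat M e (ren_fm f \<psi>) \<longleftrightarrow> sat M e' \<psi>"
    using Conj.prems by (auto intro!: Conj.IH[of N])
  then show ?case by simp
next
  case (Neg \<phi>)
  have "sat M e (ren_fm f \<phi>) \<longleftrightarrow> sat M e' \<phi>"
    using Neg.prems by (auto intro!: Neg.IH[of N])
  then show ?case by simp
qed

lemma sat_inst:
  "wf_fm (length vs) \<phi> \<Longrightarrow> sat M e (inst \<phi> vs) \<longleftrightarrow> sat M (map ((!) e) vs) \<phi>"
  unfolding inst_def by (rule sat_ren) auto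

lemma wf_ren:
  "wf_fm N \<phi> \<Longrightarrow> (\<And>i. i < N \<Longrightarrow> f i < K) \<Longrightarrow> wf_fm K (ren_fm f \<phi>)"
proof (induction \<phi> arbitrary: N K f)
  case (Eq s t)
  have "wf_tm N u \<Longrightarrow> wf_tm K (ren_tm f u)" for u
    using Eq.prems(2) by (induction u) auto
  with Eq.prems(1) show ?case by simp
next
  case (Ex \<phi>)
  have "wf_fm (Suc K) (ren_fm (case_nat 0 (\<lambda>i. Suc (f i))) \<phi>)"
    using Ex.prems by (intro Ex.IH[of "Suc N"]) (auto split: nat.split)
  then show ?case by simp
qed auto

lemma wf_inst:
  "wf_fm (length vs) \<phi> \<Longrightarrow> \<forall>v\<in>set vs. v < K \<Longrightarrow> wf_fm K (inst \<phi> vs)"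
  unfolding inst_def by (rule wf_ren) auto

text \<open>The last entry is split off because the outermost quantifier of \<open>Exs\<close> binds
  the last entry of the block.\<close>

lemma tuples_Suc: "w \<in> tuples M (Suc n) \<longleftrightarrow> (\<exists>a\<in>carrier M. \<exists>u\<in>tuples M n. w = u @ [a])"
proof
  assume w: "w \<in> tuples M (Suc n)"
  then have "w = butlast w @ [last w]"
    by (intro append_butlast_last_id[symmetric]) (auto simp: tuples_def)
  with w show "\<exists>a\<in>carrier M. \<exists>u\<in>tuples M n. w = u @ [a]"
    unfolding tuples_def
    by (intro bexI[of _ "last w"] bexI[of _ "butlast w"])
      (auto dest: in_set_butlastD intro: last_in_set)
qed (auto simp: tuples_def)

lemma sat_Exs: "sat M e (Exs n \<phi>) \<longleftrightarrow> (\<exists>u\<in>tuples M n. sat M (u @ e) \<phi>)"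
proof (induction n arbitrary: e)
  case 0
  then show ?case by (auto simp: Exs_def tuples_def)
next
  case (Suc n)
  have "sat M e (Exs (Suc n) \<phi>) \<longleftrightarrow> (\<exists>a\<in>carrier M. sat M (a # e) (Exs n \<phi>))"
    by (simp add: Exs_def)
  also have "\<dots> \<longleftrightarrow> (\<exists>u\<in>tuples M (Suc n). sat M (u @ e) \<phi>)"
    unfolding Suc.IH tuples_Suc Bex_def[of "tuples M (Suc n)"] by fastforce
  finally show ?case .
qed

lemma sat_conjs: "sat M e (conjs \<phi>s) \<longleftrightarrow> (\<forall>\<phi>\<in>set \<phi>s. sat M e \<phi>)"
  by (induction \<phi>s) (auto simp: conjs_def)

lemma wf_conjs [simp]: "wf_fm N (conjs \<phi>s) \<longleftrightarrow> (\<forall>\<phi>\<in>set \<phi>s. wf_fm N \<phi>)"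
  by (induction \<phi>s) (auto simp: conjs_def)

definition Forall :: "fm \<Rightarrow> fm" where "Forall \<phi> = Neg (Ex (Neg \<phi>))"
definition Implies :: "fm \<Rightarrow> fm \<Rightarrow> fm" where "Implies \<phi> \<psi> = Neg (Conj \<phi> (Neg \<psi>))"

lemma sat_Forall [simp]: "sat M e (Forall \<phi>) \<longleftrightarrow> (\<forall>a\<in>carrier M. sat M (a # e) \<phi>)"
  by (simp add: Forall_def)
lemma wf_Forall [simp]: "wf_fm N (Forall \<phi>) \<longleftrightarrow> wf_fm (Suc N) \<phi>"
  by (simp add: Forall_def)
lemma sat_Implies [simp]: "sat M e (Implies \<phi> \<psi>) \<longleftrightarrow> (sat M e \<phi> \<longrightarrow> sat M e \<psi>)"
  by (simp add: Implies_def)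
lemma wf_Implies [simp]: "wf_fm N (Implies \<phi> \<psi>) \<longleftrightarrow> wf_fm N \<phi> \<and> wf_fm N \<psi>"
  by (simp add: Implies_def)

text \<open>Structures are bare records. Closure puts the value of a term into the carrier, where
  surjectivity of a coordinate map provides a representative for it.\<close>

definition closed_struct :: "'a ring \<Rightarrow> bool" where
  "closed_struct A \<longleftrightarrow> \<zero>\<^bsub>A\<^esub> \<in> carrier A \<and> \<one>\<^bsub>A\<^esub> \<in> carrier A \<and>
     (\<forall>x\<in>carrier A. \<forall>y\<in>carrier A. x \<oplus>\<^bsub>A\<^esub> y \<in> carrier A \<and> x \<otimes>\<^bsub>A\<^esub> y \<in> carrier A)"

lemma tm_val_closed:
  "closed_struct A \<Longrightarrow> wf_tm N t \<Longrightarrow> (\<And>i. i < N \<Longrightarrow> e ! i \<in> carrier A) \<Longrightarrow>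
    tm_val A e t \<in> carrier A"
  by (induction t) (auto simp: closed_struct_def)

text \<open>A form of \<open>coordinate_map\<close> that avoids the quotient, and is therefore easier to compose.\<close>

definition coordinatization ::
  "code \<Rightarrow> 'b ring \<Rightarrow> 'b list \<Rightarrow> 'a ring \<Rightarrow> ('b list \<Rightarrow> 'a) \<Rightarrow> bool" where
  "coordinatization \<Gamma> M p A \<mu> \<longleftrightarrow> closed_struct A \<and> length p = cpar \<Gamma> \<and>
     \<mu> ` dom_set \<Gamma> M p = carrier A \<and>
     (\<forall>u\<in>dom_set \<Gamma> M p. (sat M (u @ p) (czero \<Gamma>) \<longleftrightarrow> \<mu> u = \<zero>\<^bsub>A\<^esub>) \<and>
        (sat M (u @ p) (cone \<Gamma>) \<longleftrightarrow> \<mu> u = \<one>\<^bsub>A\<^esub>) \<and>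
        (\<forall>v\<in>dom_set \<Gamma> M p. (sat M (u @ v @ p) (ceq \<Gamma>) \<longleftrightarrow> \<mu> u = \<mu> v) \<and>
           (\<forall>w\<in>dom_set \<Gamma> M p. (sat M (u @ v @ w @ p) (cadd \<Gamma>) \<longleftrightarrow> \<mu> w = \<mu> u \<oplus>\<^bsub>A\<^esub> \<mu> v) \<and>
              (sat M (u @ v @ w @ p) (cmul \<Gamma>) \<longleftrightarrow> \<mu> w = \<mu> u \<otimes>\<^bsub>A\<^esub> \<mu> v))))"

text \<open>The equivalence classes are the fibres of \<open>\<mu>\<close> over the carrier, and
  each constant or operation of the code, evaluated at representatives, yields a whole fibre. So the
  quotient is the set of fibres, and sending a fibre to its base point is the isomorphism.\<close>

lemma coordinatization_imp_coordinate_map: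
  assumes "coordinatization \<Gamma> M p A \<mu>"
  shows "coordinate_map \<Gamma> M p A \<mu>"
proof -
  define D E where "D = dom_set \<Gamma> M p" and "E = eq_rel \<Gamma> M p"
  define fib where "fib x = {w \<in> D. \<mu> w = x}" for x
  note c = assms[unfolded coordinatization_def, folded D_def]
  have cl: "\<zero>\<^bsub>A\<^esub> \<in> carrier A" "\<one>\<^bsub>A\<^esub> \<in> carrier A"
    "\<And>x y. x \<in> carrier A \<Longrightarrow> y \<in> carrier A \<Longrightarrow> x \<oplus>\<^bsub>A\<^esub> y \<in> carrier A"
    "\<And>x y. x \<in> carrier A \<Longrightarrow> y \<in> carrier A \<Longrightarrow> x \<otimes>\<^bsub>A\<^esub> y \<in> carrier A"
    using c by (auto simp: closed_struct_def)
  have im: "\<mu> ` D = carrier A" using c by blast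
  have E: "E = {(u, v) \<in> D \<times> D. \<mu> u = \<mu> v}"
    using c unfolding E_def eq_rel_def D_def by auto
  have cls: "E `` {u} = fib (\<mu> u)" if "u \<in> D" for u
    using that by (auto simp: E fib_def)
  have quot: "D // E = fib ` carrier A"
    unfolding quotient_def im[symmetric] using cls by auto
  have z: "const_val (czero \<Gamma>) \<Gamma> M p = fib \<zero>\<^bsub>A\<^esub>" and o: "const_val (cone \<Gamma>) \<Gamma> M p = fib \<one>\<^bsub>A\<^esub>"
    using c unfolding const_val_def fib_def D_def by auto
  have ad: "op_val (cadd \<Gamma>) \<Gamma> M p u v = fib (\<mu> u \<oplus>\<^bsub>A\<^esub> \<mu> v)"
    and mu: "op_val (cmul \<Gamma>) \<Gamma> M p u v = fib (\<mu> u \<otimes>\<^bsub>A\<^esub> \<mu> v)" if "u \<in> D" "v \<in> D" for u v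
    using c that unfolding op_val_def fib_def D_def by auto
  have muc: "\<mu> u \<in> carrier A" if "u \<in> D" for u using that im by blast
  have fib_ne: "\<exists>u. u \<in> fib x" if "x \<in> carrier A" for x
    using that unfolding im[symmetric] fib_def by blast
  have inj: "x = y" if "fib x = fib y" "x \<in> carrier A" for x y
    using fib_ne[OF that(2)] that(1) by (auto simp: fib_def)
  have equiv: "equiv D E"
    by (auto simp: equiv_def refl_on_def sym_def trans_def E)
  have ops: "op_defines (cadd \<Gamma>) \<Gamma> M p" "op_defines (cmul \<Gamma>) \<Gamma> M p"
    unfolding op_defines_def D_def[symmetric] E_def[symmetric] quot congruent2_def
    by (auto simp: E ad mu intro!: imageI cl muc)
  have defs: "code_defines \<Gamma> M p"
    unfolding code_defines_def D_def[symmetric] E_def[symmetric]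
    using equiv ops cl by (auto simp: quot z o)
  \<comment> \<open>The base point is unique because fibres over the carrier are nonempty, which
    makes \<open>fib\<close> injective there.\<close>
  define h where "h X = (THE x. x \<in> carrier A \<and> X = fib x)" for X
  have h: "h (fib x) = x" if "x \<in> carrier A" for x
    unfolding h_def using that inj by (intro the_equality) auto
  have un: "(\<Union>u\<in>fib x. \<Union>v\<in>fib y. op_val (cadd \<Gamma>) \<Gamma> M p u v) = fib (x \<oplus>\<^bsub>A\<^esub> y)"
    "(\<Union>u\<in>fib x. \<Union>v\<in>fib y. op_val (cmul \<Gamma>) \<Gamma> M p u v) = fib (x \<otimes>\<^bsub>A\<^esub> y)"
    if xy: "x \<in> carrier A" "y \<in> carrier A" for x y
  proof -
    \<comment> \<open>The union in \<open>defined_struct\<close> runs over a constant family; it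
      collapses to that constant because both fibres are nonempty.\<close>
    obtain u v where "u \<in> fib x" "v \<in> fib y" using fib_ne xy by blast
    then have ne: "fib x \<noteq> {}" "fib y \<noteq> {}" by auto
    have "op_val (cadd \<Gamma>) \<Gamma> M p u v = fib (x \<oplus>\<^bsub>A\<^esub> y)"
      "op_val (cmul \<Gamma>) \<Gamma> M p u v = fib (x \<otimes>\<^bsub>A\<^esub> y)"
      if "u \<in> fib x" "v \<in> fib y" for u v
      using that ad mu by (auto simp: fib_def)
    then show "(\<Union>u\<in>fib x. \<Union>v\<in>fib y. op_val (cadd \<Gamma>) \<Gamma> M p u v) = fib (x \<oplus>\<^bsub>A\<^esub> y)"
      "(\<Union>u\<in>fib x. \<Union>v\<in>fib y. op_val (cmul \<Gamma>) \<Gamma> M p u v) = fib (x \<otimes>\<^bsub>A\<^esub> y)"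
      using ne by simp_all
  qed
  have iso: "h \<in> struct_iso (defined_struct \<Gamma> M p) A"
    unfolding struct_iso_def
  proof (intro CollectI conjI)
    show "h \<in> ring_hom (defined_struct \<Gamma> M p) A"
      unfolding ring_hom_def defined_struct_def D_def[symmetric] E_def[symmetric] quot
      by (auto simp: h un cl o)
    show "h \<zero>\<^bsub>defined_struct \<Gamma> M p\<^esub> = \<zero>\<^bsub>A\<^esub>"
      by (simp add: defined_struct_def z h cl)
    show "bij_betw h (carrier (defined_struct \<Gamma> M p)) (carrier A)"
      unfolding defined_struct_def D_def[symmetric] E_def[symmetric] quot partial_object.simps
      by (auto simp: bij_betw_def inj_on_def h image_image)
  qed
  show ?thesis
    unfolding coordinate_map_def D_def[symmetric] E_def[symmetric]
    using defs im iso by (auto intro!: bexI[of _ h] simp: cls h muc)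
qed

text \<open>Allows a coordinate map to be followed by an isomorphism. It is applied to the
  automorphism of the polynomial ring that substitutes the parameter \<open>t\<close> for the
  indeterminate.\<close>

lemma coordinatization_hom:
  assumes "coordinatization \<Gamma> M p A \<mu>" and "closed_struct A'"
    and "bij_betw h (carrier A) (carrier A')" "h \<zero>\<^bsub>A\<^esub> = \<zero>\<^bsub>A'\<^esub>" "h \<one>\<^bsub>A\<^esub> = \<one>\<^bsub>A'\<^esub>"
    and "\<And>x y. x \<in> carrier A \<Longrightarrow> y \<in> carrier A \<Longrightarrow> h (x \<oplus>\<^bsub>A\<^esub> y) = h x \<oplus>\<^bsub>A'\<^esub> h y"
    and "\<And>x y. x \<in> carrier A \<Longrightarrow> y \<in> carrier A \<Longrightarrow> h (x \<otimes>\<^bsub>A\<^esub> y) = h x \<otimes>\<^bsub>A'\<^esub> h y"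
  shows "coordinatization \<Gamma> M p A' (\<lambda>u. h (\<mu> u))"
proof -
  have inj: "h x = h y \<longleftrightarrow> x = y" if "x \<in> carrier A" "y \<in> carrier A" for x y
    using assms(3) that by (auto simp: bij_betw_def inj_on_def)
  note c = assms(1)[unfolded coordinatization_def closed_struct_def]
  have \<mu>: "\<mu> u \<in> carrier A" if "u \<in> dom_set \<Gamma> M p" for u using c that by blast
  have im: "(\<lambda>u. h (\<mu> u)) ` dom_set \<Gamma> M p = carrier A'"
    using c assms(3) by (metis bij_betw_def image_image)
  show ?thesis
    unfolding coordinatization_def
    using c im assms(2) by (simp add: \<mu> flip: assms(4-7) add: inj)
qed

lemma regular_interpretationI:
  assumes "wf_code \<Gamma>" "wf_fm (cpar \<Gamma>) \<phi>" "solutions B (cpar \<Gamma>) \<phi> \<noteq> {}"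
    and "\<And>p. p \<in> solutions B (cpar \<Gamma>) \<phi> \<Longrightarrow> coordinatization \<Gamma> B p A (\<mu> p)"
  shows "regular_interpretation \<Gamma> \<phi> A B"
  using assms coordinatization_imp_coordinate_map
  unfolding regular_interpretation_def coordinate_map_def by blast

section \<open>Translation and composition\<close>

lemma map_nth_shift [simp]: "length a = n \<Longrightarrow> map ((!) (a @ e)) (shift n vs) = map ((!) e) vs"
  by (auto simp: shift_def nth_append)

lemma nth_append_eqs:
  assumes "length a = n" "length b = n"
  shows "map ((!) (a @ b @ e)) [0..<n] = a" "map ((!) (a @ b @ e)) [n..<2 * n] = b"
  using assms by (auto intro!: nth_equalityI simp: nth_append)

lemma tuples_double:
  "(\<exists>u\<in>tuples M (2 * n). P u) \<longleftrightarrow> (\<exists>a\<in>tuples M n. \<exists>b\<in>tuples M n. P (a @ b))"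
proof (intro iffI)
  assume "\<exists>u\<in>tuples M (2 * n). P u"
  then obtain u where u: "u \<in> tuples M (2 * n)" "P u" by blast
  have "take n u \<in> tuples M n" "drop n u \<in> tuples M n"
    using u(1) by (auto simp: tuples_def dest: in_set_takeD in_set_dropD)
  with u(2) show "\<exists>a\<in>tuples M n. \<exists>b\<in>tuples M n. P (a @ b)"
    by (intro bexI[of _ "take n u"] bexI[of _ "drop n u"]) auto
next
  assume "\<exists>a\<in>tuples M n. \<exists>b\<in>tuples M n. P (a @ b)"
  then obtain a b where "a \<in> tuples M n" "b \<in> tuples M n" "P (a @ b)" by blast
  then show "\<exists>u\<in>tuples M (2 * n). P u"
    by (intro bexI[of _ "a @ b"]) (auto simp: tuples_def)
qed

lemma dom_set_tuples: "u \<in> dom_set \<Gamma> M p \<Longrightarrow> u \<in> tuples M (cdim \<Gamma>)"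
  by (simp add: dom_set_def)

lemma dom_set_length: "u \<in> dom_set \<Gamma> M p \<Longrightarrow> length u = cdim \<Gamma>"
  by (simp add: dom_set_def tuples_def)

section \<open>Correctness of the translation of formulas\<close>

context
  fixes \<Delta> :: code and C :: "'c ring" and q :: "'c list" and B :: "'b ring" and \<nu> :: "'c list \<Rightarrow> 'b"
  assumes wf: "wf_code \<Delta>" and co: "coordinatization \<Delta> C q B \<nu>"
begin

lemma shift_pair:
  assumes "a \<in> dom_set \<Delta> C q" "b \<in> dom_set \<Delta> C q"
  shows "map ((!) (a @ b @ e)) (shift (2 * cdim \<Delta>) vs) = map ((!) e) vs"
  using map_nth_shift[of "a @ b" "2 * cdim \<Delta>" e vs] assms[THEN dom_set_length] by simp

text \<open>The length of \<open>z\<close> is left open: it is empty when \<open>\<phi>\<close> is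
  the equality of the code and one block when \<open>\<phi>\<close> is the graph of an
  operation.\<close>

lemma sat_tr_binop:
  assumes "wf_fm (2 * cdim \<Delta> + length z + cpar \<Delta>) \<phi>" and q: "map ((!) e) \<pi> = q"
  shows "sat C e (tr_binop \<phi> \<Delta> \<pi> z F G) \<longleftrightarrow>
    (\<exists>a\<in>dom_set \<Delta> C q. \<exists>b\<in>dom_set \<Delta> C q. sat C (a @ b @ e) F \<and> sat C (a @ b @ e) G \<and>
       sat C (a @ b @ map ((!) e) z @ q) \<phi>)"
proof -
  define n where "n = cdim \<Delta>"
  have wfd: "wf_fm (n + cpar \<Delta>) (cdom \<Delta>)" and lq: "length q = cpar \<Delta>"
    using wf co by (auto simp: wf_code_def coordinatization_def n_def)
  then have l\<pi>: "length \<pi> = cpar \<Delta>" using q by auto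
  have sh: "length (shift k vs) = length vs" for k vs by (simp add: shift_def)
  have "wf_fm (length ([0..<n] @ [n..<2 * n] @ shift (2 * n) z @ shift (2 * n) \<pi>)) \<phi>"
    using assms(1) by (simp add: sh l\<pi> n_def mult_2 add.assoc)
  note inst_\<phi> = sat_inst[OF this]
  have inst_dom: "wf_fm (length ([0..<n] @ shift (2 * n) \<pi>)) (cdom \<Delta>)"
    "wf_fm (length ([n..<2 * n] @ shift (2 * n) \<pi>)) (cdom \<Delta>)"
    using wfd by (simp_all add: sh l\<pi>)
  have "sat C ((a @ b) @ e) (conjs [inst (cdom \<Delta>) ([0..<n] @ shift (2 * n) \<pi>),
      inst (cdom \<Delta>) ([n..<2 * n] @ shift (2 * n) \<pi>), F, G,
         inst \<phi> ([0..<n] @ [n..<2 * n] @ shift (2 * n) z @ shift (2 * n) \<pi>)]) \<longleftrightarrow>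
     a \<in> dom_set \<Delta> C q \<and> b \<in> dom_set \<Delta> C q \<and> sat C (a @ b @ e) F \<and> sat C (a @ b @ e) G \<and>
       sat C (a @ b @ map ((!) e) z @ q) \<phi>"
    if a: "a \<in> tuples C n" and b: "b \<in> tuples C n" for a b
  proof -
    have l: "length a = n" "length b = n" using a b by (auto simp: tuples_def)
    have m: "map ((!) (a @ b @ e)) (shift (2 * n) vs) = map ((!) e) vs" for vs
      using map_nth_shift[of "a @ b" "2 * n" e vs] l by simp
    show ?thesis
      using a b by (simp add: sat_conjs inst_\<phi> inst_dom[THEN sat_inst] nth_append_eqs l m q
          dom_set_def flip: n_def)
  qed
  then have "sat C e (tr_binop \<phi> \<Delta> \<pi> z F G) \<longleftrightarrow>
    (\<exists>a\<in>tuples C n. \<exists>b\<in>tuples C n. a \<in> dom_set \<Delta> C q \<and> b \<in> dom_set \<Delta> C q \<and>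
       sat C (a @ b @ e) F \<and> sat C (a @ b @ e) G \<and> sat C (a @ b @ map ((!) e) z @ q) \<phi>)"
    unfolding tr_binop_def Let_def sat_Exs n_def[symmetric] tuples_double
    by (intro bex_cong refl) auto
  moreover have "a \<in> tuples C n" if "a \<in> dom_set \<Delta> C q" for a
    using that by (simp add: dom_set_def n_def)
  ultimately show ?thesis by blast
qed

text \<open>Environments and blocks are quantified inside, so that the induction on terms can use
  the property after two fresh blocks have been bound and all other variables shifted.\<close>

definition tr_tm_correct :: "nat \<Rightarrow> tm \<Rightarrow> bool" where
  "tr_tm_correct N t \<longleftrightarrow> (\<forall>e \<sigma> \<pi> z. map ((!) e) \<pi> = q \<longrightarrow>
     (\<forall>i<N. map ((!) e) (\<sigma> i) \<in> dom_set \<Delta> C q) \<longrightarrow> map ((!) e) z \<in> dom_set \<Delta> C q \<longrightarrow>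
     (sat C e (tr_tm \<Delta> \<sigma> \<pi> z t) \<longleftrightarrow>
        \<nu> (map ((!) e) z) = tm_val B (map (\<lambda>i. \<nu> (map ((!) e) (\<sigma> i))) [0..<N]) t))"

text \<open>Closure of \<open>B\<close> and surjectivity of \<open>\<nu>\<close> give
  representatives of the values of \<open>s\<close> and \<open>t\<close>; as \<open>\<phi>\<close>
  depends only on the represented values, any choice gives the same answer. Sums, products and
  equations are all instances.\<close>

lemma sat_tr_binop_tm:
  fixes e \<sigma> \<pi> z N
  defines "e' \<equiv> map (\<lambda>i. \<nu> (map ((!) e) (\<sigma> i))) [0..<N]"
  assumes "tr_tm_correct N s" "tr_tm_correct N t" "wf_tm N s" "wf_tm N t"
    and q: "map ((!) e) \<pi> = q" and d: "\<And>i. i < N \<Longrightarrow> map ((!) e) (\<sigma> i) \<in> dom_set \<Delta> C q"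
    and "wf_fm (2 * cdim \<Delta> + length z + cpar \<Delta>) \<phi>"
    and P: "\<And>a b. a \<in> dom_set \<Delta> C q \<Longrightarrow> b \<in> dom_set \<Delta> C q \<Longrightarrow>
      sat C (a @ b @ map ((!) e) z @ q) \<phi> \<longleftrightarrow> P (\<nu> a) (\<nu> b)"
  shows "sat C e (tr_binop \<phi> \<Delta> \<pi> z
      (tr_tm \<Delta> (\<lambda>i. shift (2 * cdim \<Delta>) (\<sigma> i)) (shift (2 * cdim \<Delta>) \<pi>) [0..<cdim \<Delta>] s)
      (tr_tm \<Delta> (\<lambda>i. shift (2 * cdim \<Delta>) (\<sigma> i)) (shift (2 * cdim \<Delta>) \<pi>) [cdim \<Delta>..<2 * cdim \<Delta>] t)) \<longleftrightarrow>
    P (tm_val B e' s) (tm_val B e' t)"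
proof -
  have im: "\<nu> ` dom_set \<Delta> C q = carrier B" and cl: "closed_struct B"
    using co by (auto simp: coordinatization_def)
  have rec: "sat C (a @ b @ e) (tr_tm \<Delta> (\<lambda>i. shift (2 * cdim \<Delta>) (\<sigma> i)) (shift (2 * cdim \<Delta>) \<pi>) [0..<cdim \<Delta>] s)
      \<longleftrightarrow> \<nu> a = tm_val B e' s"
    "sat C (a @ b @ e) (tr_tm \<Delta> (\<lambda>i. shift (2 * cdim \<Delta>) (\<sigma> i)) (shift (2 * cdim \<Delta>) \<pi>) [cdim \<Delta>..<2 * cdim \<Delta>] t)
      \<longleftrightarrow> \<nu> b = tm_val B e' t"
    if a: "a \<in> dom_set \<Delta> C q" and b: "b \<in> dom_set \<Delta> C q" for a b
  proof -
    note m = shift_pair[OF a b] nth_append_eqs[OF dom_set_length[OF a] dom_set_length[OF b]]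
    show "sat C (a @ b @ e) (tr_tm \<Delta> (\<lambda>i. shift (2 * cdim \<Delta>) (\<sigma> i)) (shift (2 * cdim \<Delta>) \<pi>) [0..<cdim \<Delta>] s)
        \<longleftrightarrow> \<nu> a = tm_val B e' s"
      using assms(2)[unfolded tr_tm_correct_def, rule_format, of "a @ b @ e" "shift (2 * cdim \<Delta>) \<pi>"
          "\<lambda>i. shift (2 * cdim \<Delta>) (\<sigma> i)" "[0..<cdim \<Delta>]"] d q a
      unfolding m e'_def by blast
    show "sat C (a @ b @ e) (tr_tm \<Delta> (\<lambda>i. shift (2 * cdim \<Delta>) (\<sigma> i)) (shift (2 * cdim \<Delta>) \<pi>) [cdim \<Delta>..<2 * cdim \<Delta>] t)
        \<longleftrightarrow> \<nu> b = tm_val B e' t"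
      using assms(3)[unfolded tr_tm_correct_def, rule_format, of "a @ b @ e" "shift (2 * cdim \<Delta>) \<pi>"
          "\<lambda>i. shift (2 * cdim \<Delta>) (\<sigma> i)" "[cdim \<Delta>..<2 * cdim \<Delta>]"] d q b
      unfolding m e'_def by blast
  qed
  have "e' ! i \<in> carrier B" if "i < N" for i
    using d[OF that] im that by (auto simp: e'_def)
  then have "tm_val B e' s \<in> carrier B" "tm_val B e' t \<in> carrier B"
    using assms(4,5) cl by (auto intro!: tm_val_closed[of B N])
  then obtain a b where ab: "a \<in> dom_set \<Delta> C q" "b \<in> dom_set \<Delta> C q"
    "\<nu> a = tm_val B e' s" "\<nu> b = tm_val B e' t"
    unfolding im[symmetric] by (metis imageE)
  have "sat C e (tr_binop \<phi> \<Delta> \<pi> z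
      (tr_tm \<Delta> (\<lambda>i. shift (2 * cdim \<Delta>) (\<sigma> i)) (shift (2 * cdim \<Delta>) \<pi>) [0..<cdim \<Delta>] s)
      (tr_tm \<Delta> (\<lambda>i. shift (2 * cdim \<Delta>) (\<sigma> i)) (shift (2 * cdim \<Delta>) \<pi>) [cdim \<Delta>..<2 * cdim \<Delta>] t)) \<longleftrightarrow>
    (\<exists>a\<in>dom_set \<Delta> C q. \<exists>b\<in>dom_set \<Delta> C q. \<nu> a = tm_val B e' s \<and> \<nu> b = tm_val B e' t \<and> P (\<nu> a) (\<nu> b))"
    unfolding sat_tr_binop[OF assms(8) q] by (intro bex_cong refl) (simp add: rec P)
  also have "\<dots> \<longleftrightarrow> P (tm_val B e' s) (tm_val B e' t)"
    using ab by metis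
  finally show ?thesis .
qed

lemma tr_tm_correct: "wf_tm N t \<Longrightarrow> tr_tm_correct N t"
proof (induction t)
  note c = co[unfolded coordinatization_def] and w = wf[unfolded wf_code_def]
  have len: "length \<pi> = cpar \<Delta>" if "map ((!) e) \<pi> = q" for \<pi> and e :: "'c list"
    using that c by auto
  have lenz: "length z = cdim \<Delta>" if "map ((!) e) z \<in> dom_set \<Delta> C q" for z and e :: "'c list"
    using dom_set_length[OF that] by simp
  {
    case (Var i)
    show ?case
      unfolding tr_tm_correct_def
    proof (intro allI impI)
      fix e \<sigma> \<pi> z
      assume *: "map ((!) e) \<pi> = q" "\<forall>i<N. map ((!) e) (\<sigma> i) \<in> dom_set \<Delta> C q" "map ((!) e) z \<in> dom_set \<Delta> C q"
      have "length (\<sigma> i) = cdim \<Delta>" "length z = cdim \<Delta>" "length \<pi> = cpar \<Delta>"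
        using * Var lenz[of e] len[of e] by auto
      then have "wf_fm (length (\<sigma> i @ z @ \<pi>)) (ceq \<Delta>)"
        using w by (simp add: mult_2 add.assoc)
      then show "sat C e (tr_tm \<Delta> \<sigma> \<pi> z (Var i)) \<longleftrightarrow> \<nu> (map ((!) e) z) =
          tm_val B (map (\<lambda>i. \<nu> (map ((!) e) (\<sigma> i))) [0..<N]) (Var i)"
        using * Var c by (auto simp: sat_inst)
    qed
  next
    case TZero
    show ?case using c w lenz len by (auto simp: tr_tm_correct_def sat_inst)
  next
    case TOne
    show ?case using c w lenz len by (auto simp: tr_tm_correct_def sat_inst)
  next
    case (TAdd s t)
    show ?case
      unfolding tr_tm_correct_def
    proof (intro allI impI)
      fix e \<sigma> \<pi> z
      assume *: "map ((!) e) \<pi> = q" "\<forall>i<N. map ((!) e) (\<sigma> i) \<in> dom_set \<Delta> C q" "map ((!) e) z \<in> dom_set \<Delta> C q"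
      show "sat C e (tr_tm \<Delta> \<sigma> \<pi> z (TAdd s t)) \<longleftrightarrow> \<nu> (map ((!) e) z) =
          tm_val B (map (\<lambda>i. \<nu> (map ((!) e) (\<sigma> i))) [0..<N]) (TAdd s t)"
        unfolding tr_tm.simps Let_def tm_val.simps
      proof (rule sat_tr_binop_tm)
        show "wf_fm (2 * cdim \<Delta> + length z + cpar \<Delta>) (cadd \<Delta>)"
          using w lenz[OF *(3)] by simp
      qed (use TAdd * c in auto)
    qed
  next
    case (TMul s t)
    show ?case
      unfolding tr_tm_correct_def
    proof (intro allI impI)
      fix e \<sigma> \<pi> z
      assume *: "map ((!) e) \<pi> = q" "\<forall>i<N. map ((!) e) (\<sigma> i) \<in> dom_set \<Delta> C q" "map ((!) e) z \<in> dom_set \<Delta> C q"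
      show "sat C e (tr_tm \<Delta> \<sigma> \<pi> z (TMul s t)) \<longleftrightarrow> \<nu> (map ((!) e) z) =
          tm_val B (map (\<lambda>i. \<nu> (map ((!) e) (\<sigma> i))) [0..<N]) (TMul s t)"
        unfolding tr_tm.simps Let_def tm_val.simps
      proof (rule sat_tr_binop_tm)
        show "wf_fm (2 * cdim \<Delta> + length z + cpar \<Delta>) (cmul \<Delta>)"
          using w lenz[OF *(3)] by simp
      qed (use TMul * c in auto)
    qed
  }
qed

text \<open>The quantifier case works because \<open>\<nu>\<close> maps the domain onto the carrier
  of \<open>B\<close>: a witness in \<open>B\<close> is the same as a block satisfying the domain
  formula.\<close>

lemma sat_tr_fm:
  assumes "wf_fm N \<phi>" "map ((!) e) \<pi> = q" "\<And>i. i < N \<Longrightarrow> map ((!) e) (\<sigma> i) \<in> dom_set \<Delta> C q"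
  shows "sat C e (tr_fm \<Delta> \<sigma> \<pi> \<phi>) \<longleftrightarrow> sat B (map (\<lambda>i. \<nu> (map ((!) e) (\<sigma> i))) [0..<N]) \<phi>"
  using assms
proof (induction \<phi> arbitrary: N e \<sigma> \<pi>)
  case (Eq s t)
  show ?case
    unfolding tr_fm.simps Let_def sat.simps
    using Eq co wf tr_tm_correct
    by (intro sat_tr_binop_tm) (auto simp: coordinatization_def wf_code_def)
next
  case (Neg \<phi>)
  then show ?case using Neg.IH[of N] by simp
next
  case (Conj \<phi> \<psi>)
  then have "wf_fm N \<phi>" "wf_fm N \<psi>" by auto
  then show ?case
    using Conj.IH(1)[of N e \<pi> \<sigma>] Conj.IH(2)[of N e \<pi> \<sigma>] Conj.prems by simp
next
  case (Ex \<phi>)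
  define n where "n = cdim \<Delta>"
  let ?\<sigma> = "case_nat [0..<n] (\<lambda>i. shift n (\<sigma> i))"
  have lq: "length q = cpar \<Delta>" and im: "carrier B = \<nu> ` dom_set \<Delta> C q"
    using co by (auto simp: coordinatization_def)
  then have "wf_fm (length ([0..<n] @ shift n \<pi>)) (cdom \<Delta>)"
    using wf Ex.prems(2) by (auto simp: wf_code_def n_def shift_def)
  note inst_dom = sat_inst[OF this]
  have m: "map ((!) (a @ e)) (shift n vs) = map ((!) e) vs" "map ((!) (a @ e)) [0..<n] = a"
    if "a \<in> tuples C n" for a vs
    using that map_nth_shift[of a n e] by (auto simp: tuples_def intro!: nth_equalityI simp: nth_append)
  have dom: "sat C (a @ e) (inst (cdom \<Delta>) ([0..<n] @ shift n \<pi>)) \<longleftrightarrow> a \<in> dom_set \<Delta> C q"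
    if "a \<in> tuples C n" for a
    using that Ex.prems(2) by (simp add: inst_dom m dom_set_def flip: n_def)
  have rec: "sat C (a @ e) (tr_fm \<Delta> ?\<sigma> (shift n \<pi>) \<phi>) \<longleftrightarrow>
      sat B (\<nu> a # map (\<lambda>i. \<nu> (map ((!) e) (\<sigma> i))) [0..<N]) \<phi>"
    if a: "a \<in> dom_set \<Delta> C q" for a
  proof -
    have at: "a \<in> tuples C n" using a by (simp add: dom_set_def n_def)
    have "sat C (a @ e) (tr_fm \<Delta> ?\<sigma> (shift n \<pi>) \<phi>) \<longleftrightarrow>
      sat B (map (\<lambda>i. \<nu> (map ((!) (a @ e)) (?\<sigma> i))) [0..<Suc N]) \<phi>"
      using Ex.prems a by (intro Ex.IH) (auto simp: m[OF at] split: nat.split)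
    also have "map (\<lambda>i. \<nu> (map ((!) (a @ e)) (?\<sigma> i))) [0..<Suc N] =
        \<nu> a # map (\<lambda>i. \<nu> (map ((!) e) (\<sigma> i))) [0..<N]"
      unfolding map_upt_Suc by (simp add: m[OF at])
    finally show ?thesis .
  qed
  show ?case
    unfolding tr_fm.simps Let_def sat_Exs sat.simps im n_def[symmetric]
    using dom rec by (auto simp: dom_set_tuples n_def)
qed

end

section \<open>Tuples of blocks and the composition of codes\<close>

definition blk :: "nat \<Rightarrow> 'c list \<Rightarrow> nat \<Rightarrow> 'c list" where
  "blk m w i = map ((!) w) [i * m..<Suc i * m]"

definition decode :: "nat \<Rightarrow> ('c list \<Rightarrow> 'b) \<Rightarrow> nat \<Rightarrow> 'c list \<Rightarrow> 'b list" where
  "decode m \<nu> n w = map (\<lambda>i. \<nu> (blk m w i)) [0..<n]"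

lemma length_decode [simp]: "length (decode m \<nu> n w) = n"
  by (simp add: decode_def)

lemma blk_append_left:
  assumes "length u = n * m" "i < n"
  shows "blk m (u @ r) i = blk m u i"
proof -
  have "Suc i * m \<le> length u" unfolding assms(1) using assms(2) by (intro mult_le_mono1) auto
  then show ?thesis by (auto simp: blk_def nth_append)
qed

lemma blk_append_right:
  assumes "length u = n * m"
  shows "blk m (u @ r) (n + i) = blk m r i"
proof -
  have "n * m + i * m + j = (n + i) * m + j" for j by (simp add: algebra_simps)
  then show ?thesis
    using assms by (intro nth_equalityI) (auto simp: blk_def nth_append algebra_simps)
qed

lemma decode_append:
  assumes "length u = n * m"
  shows "decode m \<nu> (n + k) (u @ r) = decode m \<nu> n u @ decode m \<nu> k r"
proof (rule nth_equalityI)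
  fix i assume "i < length (decode m \<nu> (n + k) (u @ r))"
  then have i: "i < n + k" by simp
  show "decode m \<nu> (n + k) (u @ r) ! i = (decode m \<nu> n u @ decode m \<nu> k r) ! i"
  proof (cases "i < n")
    case True
    then show ?thesis using i by (simp add: decode_def nth_append blk_append_left[OF assms])
  next
    case False
    then obtain j where "i = n + j" by (metis le_add_diff_inverse not_less)
    then show ?thesis using i assms by (simp add: decode_def nth_append blk_append_right)
  qed
qed simp

lemma blk_tuples: "w \<in> tuples M (n * m) \<Longrightarrow> i < n \<Longrightarrow> blk m w i \<in> tuples M m"
proof -
  assume w: "w \<in> tuples M (n * m)" and i: "i < n"
  have "Suc i * m \<le> length w" using w i mult_le_mono1[of "Suc i" n m] by (simp add: tuples_def)
  with w show "blk m w i \<in> tuples M m"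
    by (auto simp: tuples_def blk_def intro!: subsetD[OF _ nth_mem])
qed

lemma blk_0: "length v = m \<Longrightarrow> blk m v 0 = v"
  by (auto simp: blk_def intro!: nth_equalityI)

lemma blk_one: "i < length w \<Longrightarrow> blk (Suc 0) w i = [w ! i]"
  by (simp add: blk_def)

lemma sat_in_dom:
  assumes "wf_code \<Delta>" and "map ((!) e) (par_vars \<Delta> N) = q"
  shows "sat C e (in_dom \<Delta> N l) \<longleftrightarrow> (\<forall>j<l. sat C (blk (cdim \<Delta>) e j @ q) (cdom \<Delta>))"
proof -
  have "wf_fm (length (block \<Delta> j @ par_vars \<Delta> N)) (cdom \<Delta>)" for j
    using assms(1) by (simp add: wf_code_def block_def par_vars_def)
  note inst = sat_inst[OF this]
  have "map ((!) e) (block \<Delta> j) = blk (cdim \<Delta>) e j" for j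
    by (simp add: block_def blk_def)
  then show ?thesis
    using assms(2) by (auto simp: in_dom_def sat_conjs inst)
qed

lemma sat_translate:
  assumes "wf_code \<Delta>" "coordinatization \<Delta> C q B \<nu>" "wf_fm N \<phi>"
    "map ((!) e) (par_vars \<Delta> N) = q" "\<forall>i<N. blk (cdim \<Delta>) e i \<in> dom_set \<Delta> C q"
  shows "sat C e (translate \<Delta> N \<phi>) \<longleftrightarrow> sat B (decode (cdim \<Delta>) \<nu> N e) \<phi>"
  unfolding translate_def decode_def blk_def block_def[symmetric]
  using assms by (intro sat_tr_fm) (auto simp: block_def blk_def)

lemma map_nth_par_vars:
  assumes "length x = N * cdim \<Delta>" "length r = k * cdim \<Delta> + cpar \<Delta>"
  shows "map ((!) (x @ r)) (par_vars \<Delta> (N + k)) = drop (k * cdim \<Delta>) r"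
  using assms by (auto intro!: nth_equalityI simp: par_vars_def algebra_simps nth_append)

text \<open>Surjectivity of \<open>\<nu>\<close> carried over to tuples, one block at a time. It
  makes the composite coordinate map surjective.\<close>

lemma ex_decode:
  assumes "\<nu> ` D = carrier B" "\<And>v. v \<in> D \<Longrightarrow> v \<in> tuples C m" "us \<in> tuples B n"
  shows "\<exists>w\<in>tuples C (n * m). (\<forall>j<n. blk m w j \<in> D) \<and> decode m \<nu> n w = us"
  using assms(3)
proof (induction n arbitrary: us)
  case 0
  then show ?case by (auto simp: tuples_def decode_def)
next
  case (Suc n)
  then obtain a us' where a: "a \<in> carrier B" and us': "us' \<in> tuples B n" and us: "us = us' @ [a]"
    unfolding tuples_Suc by blast
  obtain v where v: "v \<in> D" "\<nu> v = a" using a assms(1) by (metis imageE)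
  obtain w where w: "w \<in> tuples C (n * m)" "\<forall>j<n. blk m w j \<in> D" "decode m \<nu> n w = us'"
    using Suc.IH[OF us'] by blast
  have l: "length w = n * m" "length v = m" using w(1) assms(2)[OF v(1)] by (auto simp: tuples_def)
  have "w @ v \<in> tuples C (Suc n * m)"
    using w(1) assms(2)[OF v(1)] by (auto simp: tuples_def)
  moreover have "blk m (w @ v) j \<in> D" if "j < Suc n" for j
  proof (cases "j < n")
    case True
    then show ?thesis using w(2) l by (simp add: blk_append_left[OF l(1)])
  next
    case False
    with that have "j = n + 0" by simp
    then show ?thesis using v blk_append_right[OF l(1), of v 0] l(2) by (simp add: blk_0)
  qed
  moreover have "decode m \<nu> (Suc n) (w @ v) = us"
    using decode_append[OF l(1), of \<nu> 1 v] l w v us by (simp add: decode_def[of m \<nu> "Suc 0"] blk_0)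
  ultimately show ?case by blast
qed

lemma all_blk_append:
  assumes "length u = n * m"
  shows "(\<forall>i<n + k. blk m (u @ r) i \<in> D) \<longleftrightarrow> (\<forall>i<n. blk m u i \<in> D) \<and> (\<forall>i<k. blk m r i \<in> D)"
proof -
  have "(\<forall>i<n + k. Q i) \<longleftrightarrow> (\<forall>i<n. Q i) \<and> (\<forall>i<k. Q (n + i))" for Q
    by (metis add_less_cancel_left le_add_diff_inverse not_less trans_less_add1)
  then show ?thesis
    using blk_append_left[OF assms] blk_append_right[OF assms] by auto
qed

text \<open>A translated formula holds of \<open>w\<close> exactly when the original holds of the
  decoded tuple, so decoding followed by \<open>\<mu>\<close> inherits every clause from
  \<open>\<mu>\<close>. The explicit domain is what the defining formulas of the coordinate maps are
  later compared with.\<close>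

lemma coordinatization_comp:
  fixes \<Gamma> \<Delta> :: code and r :: "'c list"
  defines "n \<equiv> cdim \<Gamma>" and "k \<equiv> cpar \<Gamma>" and "m \<equiv> cdim \<Delta>"
  assumes wf\<Gamma>: "wf_code \<Gamma>" and wf\<Delta>: "wf_code \<Delta>"
    and co\<Delta>: "coordinatization \<Delta> C (drop (k * m) r) B \<nu>"
    and co\<Gamma>: "coordinatization \<Gamma> B (decode m \<nu> k r) A \<mu>"
    and lr: "length r = k * m + cpar \<Delta>"
    and rdom: "\<forall>j<k. blk m r j \<in> dom_set \<Delta> C (drop (k * m) r)"
  shows "coordinatization (comp_code \<Gamma> \<Delta>) C r A (\<lambda>w. \<mu> (decode m \<nu> n w))"
    and "dom_set (comp_code \<Gamma> \<Delta>) C r = {w \<in> tuples C (n * m).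
      (\<forall>j<n. blk m w j \<in> dom_set \<Delta> C (drop (k * m) r)) \<and>
      decode m \<nu> n w \<in> dom_set \<Gamma> B (decode m \<nu> k r)}"
proof -
  define q p where "q = drop (k * m) r" and "p = decode m \<nu> k r"
  define D where "D = dom_set \<Delta> C q"
  define G where "G = {w \<in> tuples C (n * m). \<forall>j<n. blk m w j \<in> D}"
  have im\<Delta>: "\<nu> ` D = carrier B" using co\<Delta> by (simp add: coordinatization_def D_def q_def)
  \<comment> \<open>Stated for an arbitrary number \<open>N\<close> of blocks, because the formulas
    of a code speak about \<open>n\<close>, \<open>2 * n\<close> or \<open>3 * n\<close> of them
    before the parameters.\<close>
  have tr: "sat C (x @ r) (translate \<Delta> (N + k) \<phi>) \<longleftrightarrow> sat B (decode m \<nu> N x @ p) \<phi>"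
    if "length x = N * m" "\<forall>i<N. blk m x i \<in> D" "wf_fm (N + k) \<phi>" for x N \<phi>
  proof -
    have "sat C (x @ r) (translate \<Delta> (N + k) \<phi>) \<longleftrightarrow> sat B (decode m \<nu> (N + k) (x @ r)) \<phi>"
      unfolding m_def
    proof (rule sat_translate[OF wf\<Delta> co\<Delta> that(3)])
      show "map ((!) (x @ r)) (par_vars \<Delta> (N + k)) = drop (k * m) r"
        using that(1) lr by (simp add: map_nth_par_vars m_def)
      show "\<forall>i<N + k. blk (cdim \<Delta>) (x @ r) i \<in> dom_set \<Delta> C (drop (k * m) r)"
        using that(1,2) rdom unfolding m_def[symmetric] by (simp add: all_blk_append D_def q_def)
    qed
    also have "decode m \<nu> (N + k) (x @ r) = decode m \<nu> N x @ p"
      unfolding p_def by (rule decode_append[OF that(1)])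
    finally show ?thesis .
  qed
  have decB: "decode m \<nu> n w \<in> tuples B n" if "w \<in> G" for w
    using that im\<Delta> by (auto simp: G_def tuples_def decode_def)
  have cd: "cdim (comp_code \<Gamma> \<Delta>) = n * m" "cpar (comp_code \<Gamma> \<Delta>) = k * m + cpar \<Delta>"
    by (simp_all add: comp_code_def Let_def n_def k_def m_def)
  have dom: "dom_set (comp_code \<Gamma> \<Delta>) C r = {w \<in> G. decode m \<nu> n w \<in> dom_set \<Gamma> B p}"
  proof -
    have "sat C (w @ r) (cdom (comp_code \<Gamma> \<Delta>)) \<longleftrightarrow>
        w \<in> G \<and> decode m \<nu> n w \<in> dom_set \<Gamma> B p" if w: "w \<in> tuples C (n * m)" for w
    proof -
      have lw: "length w = n * m" using w by (simp add: tuples_def)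
      have "sat C (w @ r) (in_dom \<Delta> (n + k) n) \<longleftrightarrow> (\<forall>j<n. sat C (blk m (w @ r) j @ q) (cdom \<Delta>))"
        unfolding m_def using lw lr
        by (intro sat_in_dom[OF wf\<Delta>]) (simp add: map_nth_par_vars m_def q_def)
      also have "\<dots> \<longleftrightarrow> (\<forall>j<n. blk m w j \<in> D)"
        using blk_tuples[OF w] blk_append_left[OF lw] by (simp add: D_def dom_set_def m_def)
      finally have "sat C (w @ r) (in_dom \<Delta> (n + k) n) \<longleftrightarrow> w \<in> G"
        using w by (simp add: G_def)
      moreover have "sat C (w @ r) (translate \<Delta> (n + k) (cdom \<Gamma>)) \<longleftrightarrow> decode m \<nu> n w \<in> dom_set \<Gamma> B p"
        if "w \<in> G"
      proof -
        have "sat C (w @ r) (translate \<Delta> (n + k) (cdom \<Gamma>)) \<longleftrightarrow> sat B (decode m \<nu> n w @ p) (cdom \<Gamma>)"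
          using that wf\<Gamma> lw by (intro tr) (auto simp: G_def wf_code_def n_def k_def)
        then show ?thesis using decB[OF that] by (simp add: dom_set_def n_def)
      qed
      moreover have "cdom (comp_code \<Gamma> \<Delta>) = Conj (in_dom \<Delta> (n + k) n) (translate \<Delta> (n + k) (cdom \<Gamma>))"
        by (simp add: comp_code_def Let_def n_def k_def)
      ultimately show ?thesis by auto
    qed
    then show ?thesis
      unfolding dom_set_def[of "comp_code \<Gamma> \<Delta>"] cd by (auto simp: G_def)
  qed
  show "dom_set (comp_code \<Gamma> \<Delta>) C r = {w \<in> tuples C (n * m).
      (\<forall>j<n. blk m w j \<in> dom_set \<Delta> C (drop (k * m) r)) \<and>
      decode m \<nu> n w \<in> dom_set \<Gamma> B (decode m \<nu> k r)}"
    unfolding dom by (auto simp: G_def D_def q_def p_def)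
  have GD: "w \<in> G \<Longrightarrow> length w = n * m \<and> (\<forall>i<n. blk m w i \<in> D)" for w
    by (auto simp: G_def tuples_def)
  have tr1: "sat C (u @ r) (translate \<Delta> (n + k) \<phi>) \<longleftrightarrow> sat B (decode m \<nu> n u @ p) \<phi>"
    if "u \<in> G" "wf_fm (n + k) \<phi>" for u \<phi>
    using that GD by (intro tr) auto
  have tr2: "sat C (u @ v @ r) (translate \<Delta> (2 * n + k) \<phi>) \<longleftrightarrow>
      sat B (decode m \<nu> n u @ decode m \<nu> n v @ p) \<phi>"
    if "u \<in> G" "v \<in> G" "wf_fm (2 * n + k) \<phi>" for u v \<phi>
  proof -
    have "\<forall>i<n + n. blk m (u @ v) i \<in> D" "decode m \<nu> (n + n) (u @ v) = decode m \<nu> n u @ decode m \<nu> n v"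
      using GD[OF that(1)] GD[OF that(2)] by (simp_all add: all_blk_append decode_append)
    then show ?thesis
      using tr[of "u @ v" "2 * n" \<phi>] that GD[of u] GD[of v] unfolding mult_2 by (simp add: distrib_right)
  qed
  have tr3: "sat C (u @ v @ w @ r) (translate \<Delta> (3 * n + k) \<phi>) \<longleftrightarrow>
      sat B (decode m \<nu> n u @ decode m \<nu> n v @ decode m \<nu> n w @ p) \<phi>"
    if "u \<in> G" "v \<in> G" "w \<in> G" "wf_fm (3 * n + k) \<phi>" for u v w \<phi>
  proof -
    have eq: "3 * n = n + (n + n)" by simp
    have "\<forall>i<n + (n + n). blk m (u @ v @ w) i \<in> D"
      "decode m \<nu> (n + (n + n)) (u @ v @ w) = decode m \<nu> n u @ decode m \<nu> n v @ decode m \<nu> n w"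
      using GD[OF that(1)] GD[OF that(2)] GD[OF that(3)] by (simp_all add: all_blk_append decode_append)
    then show ?thesis
      using tr[of "u @ v @ w" "3 * n" \<phi>] that GD[of u] GD[of v] GD[of w] unfolding eq by (simp add: distrib_right)
  qed
  note c = co\<Gamma>[unfolded coordinatization_def, folded p_def]
  have "(\<lambda>w. \<mu> (decode m \<nu> n w)) ` dom_set (comp_code \<Gamma> \<Delta>) C r = \<mu> ` dom_set \<Gamma> B p"
  proof -
    have "\<exists>w\<in>dom_set (comp_code \<Gamma> \<Delta>) C r. decode m \<nu> n w = us" if us: "us \<in> dom_set \<Gamma> B p" for us
      using ex_decode[OF im\<Delta>, of C m us n] us dom_set_tuples[OF us]
      unfolding dom by (auto simp: G_def n_def m_def D_def dest: dom_set_tuples)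
    then have "decode m \<nu> n ` dom_set (comp_code \<Gamma> \<Delta>) C r = dom_set \<Gamma> B p"
      unfolding dom by force
    then show ?thesis by (metis image_image)
  qed
  then show "coordinatization (comp_code \<Gamma> \<Delta>) C r A (\<lambda>w. \<mu> (decode m \<nu> n w))"
    unfolding coordinatization_def cd
    using c lr wf\<Gamma>
    unfolding dom
    by (simp add: tr1 tr2 tr3 wf_code_def comp_code_def Let_def flip: n_def k_def)
qed

text \<open>Supplies the hypotheses of \<open>coordinatization_comp\<close>. The tail of
  \<open>r\<close> is recognised as admissible first, since only then is there a coordinate map
  through which the translation of \<open>\<phi>\<close> can be read.\<close>

lemma solutions_comp_adm:
  fixes \<Gamma> \<Delta> :: code and r :: "'c list"
  defines "k \<equiv> cpar \<Gamma>" and "m \<equiv> cdim \<Delta>"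
  assumes wf: "wf_code \<Delta>" "wf_fm (cpar \<Gamma>) \<phi>" "wf_fm (cpar \<Delta>) \<psi>"
    and co: "\<And>q. q \<in> solutions C (cpar \<Delta>) \<psi> \<Longrightarrow> coordinatization \<Delta> C q B (\<nu> q)"
    and r: "r \<in> solutions C (cpar (comp_code \<Gamma> \<Delta>)) (comp_adm \<Gamma> \<phi> \<Delta> \<psi>)"
  shows "length r = k * m + cpar \<Delta>" "drop (k * m) r \<in> solutions C (cpar \<Delta>) \<psi>"
    "\<forall>j<k. blk m r j \<in> dom_set \<Delta> C (drop (k * m) r)"
    "decode m (\<nu> (drop (k * m) r)) k r \<in> solutions B k \<phi>"
proof -
  define q where "q = drop (k * m) r"
  have rt: "r \<in> tuples C (k * m + cpar \<Delta>)"
    using r by (simp add: solutions_def comp_code_def Let_def k_def m_def)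
  then show lr: "length r = k * m + cpar \<Delta>" by (simp add: tuples_def)
  have adm: "sat C r (inst \<psi> (par_vars \<Delta> k))" "sat C r (in_dom \<Delta> k k)" "sat C r (translate \<Delta> k \<phi>)"
    using r by (simp_all add: solutions_def comp_adm_def k_def)
  have pv: "map ((!) r) (par_vars \<Delta> k) = q"
    using map_nth_par_vars[of "[]" 0 \<Delta> r k] lr by (simp add: q_def m_def)
  have "q \<in> tuples C (cpar \<Delta>)" using rt by (auto simp: q_def tuples_def dest: in_set_dropD)
  moreover have "sat C q \<psi>"
    using adm(1) wf(3) pv sat_inst[of "par_vars \<Delta> k" \<psi> C r] by (simp add: par_vars_def)
  ultimately have q: "q \<in> solutions C (cpar \<Delta>) \<psi>" by (simp add: solutions_def)
  then show "drop (k * m) r \<in> solutions C (cpar \<Delta>) \<psi>" by (simp add: q_def)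
  have "take (k * m) r \<in> tuples C (k * m)" using rt by (auto simp: tuples_def dest: in_set_takeD)
  then have blk: "blk m r j \<in> tuples C m" if "j < k" for j
    using blk_tuples[OF _ that] blk_append_left[of "take (k * m) r" k m j "drop (k * m) r"] that lr
    by simp
  have "\<forall>j<k. sat C (blk m r j @ q) (cdom \<Delta>)"
    using adm(2) sat_in_dom[OF wf(1) pv] by (simp add: m_def)
  then show dom: "\<forall>j<k. blk m r j \<in> dom_set \<Delta> C (drop (k * m) r)"
    using blk by (simp add: dom_set_def q_def m_def)
  have "sat B (decode m (\<nu> q) k r) \<phi>"
    using sat_translate[OF wf(1) co[OF q] _ pv, of \<phi>] wf(2) dom adm(3) by (simp add: m_def k_def q_def)
  moreover have "decode m (\<nu> q) k r \<in> tuples B k"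
    using dom co[OF q] by (auto simp: decode_def tuples_def coordinatization_def q_def)
  ultimately show "decode m (\<nu> (drop (k * m) r)) k r \<in> solutions B k \<phi>"
    by (simp add: solutions_def q_def)
qed

section \<open>Coding polynomials by integers\<close>

text \<open>The factor \<open>z\<^sup>2\<close> makes the representable numbers closed under exact division, so that no
  descent as in Lagrange's theorem is needed.\<close>

definition scaled_four_squares :: "int \<Rightarrow> bool" where
  "scaled_four_squares x \<longleftrightarrow> (\<exists>z a b c d. z \<noteq> 0 \<and> x * z * z = a * a + b * b + c * c + d * d)"

text \<open>Euler's four-square identity, with the scales multiplied.\<close>

lemma scaled_four_squares_mult:
  assumes "scaled_four_squares x" "scaled_four_squares y"
  shows "scaled_four_squares (x * y)"
proof -
  obtain z a b c d where x: "z \<noteq> 0" "x * z * z = a * a + b * b + c * c + d * d"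
    using assms(1) by (auto simp: scaled_four_squares_def)
  obtain w e f g h where y: "w \<noteq> 0" "y * w * w = e * e + f * f + g * g + h * h"
    using assms(2) by (auto simp: scaled_four_squares_def)
  have "x * y * (z * w) * (z * w) = (x * z * z) * (y * w * w)" by (simp add: algebra_simps)
  also have "\<dots> = (a*e + b*f + c*g + d*h) * (a*e + b*f + c*g + d*h) +
      (a*f - b*e + c*h - d*g) * (a*f - b*e + c*h - d*g) +
      (a*g - c*e + d*f - b*h) * (a*g - c*e + d*f - b*h) +
      (a*h - d*e + b*g - c*f) * (a*h - d*e + b*g - c*f)"
    unfolding x y by (simp add: algebra_simps)
  finally show ?thesis
    unfolding scaled_four_squares_def using x(1) y(1) by (metis mult_eq_0_iff)
qed

text \<open>Multiplying \<open>x * y\<close> by \<open>y\<close> once more leaves \<open>x\<close>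
  times a square, and the square is absorbed into the scale.\<close>

lemma scaled_four_squares_divide:
  assumes "scaled_four_squares (x * y)" "scaled_four_squares y" "y \<noteq> 0"
  shows "scaled_four_squares x"
proof -
  obtain z a b c d where z: "z \<noteq> 0" "x * y * y * z * z = a * a + b * b + c * c + d * d"
    using scaled_four_squares_mult[OF assms(1,2)] by (auto simp: scaled_four_squares_def)
  then have "x * (y * z) * (y * z) = a * a + b * b + c * c + d * d" by (simp add: algebra_simps)
  then show ?thesis
    unfolding scaled_four_squares_def using z(1) assms(3) by (metis mult_eq_0_iff)
qed

text \<open>Pigeonhole: with \<open>p = 2 * h + 1\<close>, the squares \<open>a * a\<close> and the
  numbers \<open>- 1 - b * b\<close> for arguments from 0 to \<open>h\<close> each fill
  \<open>h + 1\<close> residue classes, so the two families share one.\<close>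

lemma prime_dvd_two_squares_plus_one:
  fixes p :: int
  assumes "prime p" "odd p"
  shows "\<exists>a b k. 0 < k \<and> k < p \<and> a * a + b * b + 1 = p * k"
proof -
  obtain h where h: "p = 2 * h + 1" using assms(2) by (auto elim: oddE)
  have p2: "p \<ge> 2" using assms(1) by (rule prime_ge_2_int)
  then have h0: "h \<ge> 1" using h by simp
  define f g where "f a = (a * a) mod p" and "g b = (- 1 - b * b) mod p" for a b :: int
  have eq: "a = b" if "a \<in> {0..h}" "b \<in> {0..h}" "p dvd a * a - b * b" for a b
  proof -
    have "p dvd (a - b) * (a + b)" using that(3) by (simp add: algebra_simps)
    then consider "p dvd a - b" | "p dvd a + b" using assms(1) prime_dvd_mult_iff by blast
    then show ?thesis
    proof cases
      case 1
      then show ?thesis using that(1,2) h zdvd_not_zless[of "a - b" p] zdvd_not_zless[of "b - a" p]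
        by (cases a b rule: linorder_cases) (auto simp: dvd_diff_commute)
    next
      case 2
      \<comment> \<open>Here \<open>a + b\<close> lies between 0 and \<open>p - 1\<close>, so it
        must be 0 and both summands vanish.\<close>
      then show ?thesis using that(1,2) h zdvd_not_zless[of "a + b" p] by (cases "a + b = 0") auto
    qed
  qed
  have injf: "inj_on f {0..h}"
    by (rule inj_onI) (auto simp: f_def mod_eq_dvd_iff intro: eq)
  have injg: "inj_on g {0..h}"
  proof (rule inj_onI)
    fix a b assume ab: "a \<in> {0..h}" "b \<in> {0..h}" "g a = g b"
    then have "p dvd b * b - a * a" by (simp add: g_def mod_eq_dvd_iff)
    then show "a = b" using eq[of b a] ab by simp
  qed
  have sub: "f ` {0..h} \<union> g ` {0..h} \<subseteq> {0..<p}" using p2 by (auto simp: f_def g_def)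
  have "f ` {0..h} \<inter> g ` {0..h} \<noteq> {}"
  proof
    assume "f ` {0..h} \<inter> g ` {0..h} = {}"
    then have "card (f ` {0..h} \<union> g ` {0..h}) = nat (h + 1) + nat (h + 1)"
      using injf injg by (simp add: card_Un_disjoint card_image)
    moreover have "card (f ` {0..h} \<union> g ` {0..h}) \<le> card {0..<p}" using sub by (intro card_mono) auto
    ultimately show False using h h0 by simp
  qed
  then obtain y where "y \<in> f ` {0..h}" "y \<in> g ` {0..h}" by blast
  then obtain a b where ab: "a \<in> {0..h}" "b \<in> {0..h}" "f a = g b" by (elim imageE) simp
  then have "p dvd a * a - (- 1 - b * b)" by (simp add: f_def g_def mod_eq_dvd_iff)
  then have "p dvd a * a + b * b + 1" by (simp add: algebra_simps)
  then obtain k where k: "a * a + b * b + 1 = p * k" by (auto elim: dvdE)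
  have "0 < a * a + b * b + 1" by (simp add: add_nonneg_pos)
  then have "0 < k" using k p2 by (simp add: zero_less_mult_iff)
  have "a * a \<le> h * h" "b * b \<le> h * h" using ab by (auto intro: mult_mono)
  then have "p * k \<le> 2 * (h * h) + 1" using k by linarith
  also have "\<dots> < p * p" using h0 by (simp add: h algebra_simps add_pos_nonneg)
  finally have "k < p" using p2 by simp
  with \<open>0 < k\<close> k show ?thesis by blast
qed

text \<open>Strong induction: a composite number is a product of smaller ones, and an odd prime has
  a multiple \<open>n * k\<close> with \<open>k < n\<close> that is a sum of squares, from which
  \<open>k\<close> can be divided out.\<close>

lemma scaled_four_squares_nat: "scaled_four_squares (int n)"
proof (induction n rule: less_induct)
  case (less n)
  have small: "scaled_four_squares 0" "scaled_four_squares 1" "scaled_four_squares 2"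
    unfolding scaled_four_squares_def
    by (rule exI[of _ 1], rule exI[of _ 0], rule exI[of _ 0], rule exI[of _ 0], rule exI[of _ 0], simp)
      (rule exI[of _ 1], rule exI[of _ 1], rule exI[of _ 0], rule exI[of _ 0], rule exI[of _ 0], simp,
       rule exI[of _ 1], rule exI[of _ 1], rule exI[of _ 1], rule exI[of _ 0], rule exI[of _ 0], simp)
  consider "n \<le> 2" | "prime n" "n > 2" | "\<not> prime n" "n > 2" by linarith
  then show ?case
  proof cases
    case 1
    then have "n = 0 \<or> n = 1 \<or> n = 2" by auto
    then show ?thesis using small by auto
  next
    case 2
    then obtain a b k where k: "0 < k" "k < int n" "a * a + b * b + 1 = int n * k"
      using prime_dvd_two_squares_plus_one[of "int n"] prime_odd_nat[of n] by auto
    then have "int n * k * 1 * 1 = a * a + b * b + 1 * 1 + 0 * 0" by simp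
    then have "scaled_four_squares (int n * k)"
      unfolding scaled_four_squares_def by (metis one_neq_zero)
    moreover have "scaled_four_squares k" using less.IH[of "nat k"] k by simp
    ultimately show ?thesis using scaled_four_squares_divide k(1) by blast
  next
    case 3
    then obtain a where a: "a dvd n" "a \<noteq> 1" "a \<noteq> n" by (auto simp: prime_nat_iff)
    then obtain b where b: "n = a * b" by (elim dvdE)
    then have "a < n" "b < n" using a 3 by (cases a; cases b; auto)+
    with b show ?thesis using less.IH scaled_four_squares_mult by auto
  qed
qed

lemma nonneg_iff_scaled_four_squares: "0 \<le> x \<longleftrightarrow> scaled_four_squares x"
proof
  assume "0 \<le> x" then show "scaled_four_squares x" using scaled_four_squares_nat[of "nat x"] by simp
next
  assume "scaled_four_squares x"
  then obtain z a b c d where z: "z \<noteq> 0" "x * z * z = a * a + b * b + c * c + d * d"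
    by (auto simp: scaled_four_squares_def)
  then have "0 \<le> x * (z * z)" by (simp add: mult.assoc)
  moreover have "0 < z * z" using z(1) by (simp add: zero_less_mult_iff) linarith
  ultimately show "0 \<le> x" by (simp add: zero_le_mult_iff)
qed

text \<open>The offset \<open>b\<close> admits negative values: for \<open>i \<ge> 0\<close> the modulus exceeds \<open>2 * b\<close>, so every value of
  modulus at most \<open>b\<close> can occur.\<close>

definition godel_beta :: "int \<Rightarrow> int \<Rightarrow> int \<Rightarrow> int" where
  "godel_beta a b i = a mod (1 + b * (i + 2)) - b"

section \<open>Goedel's beta function\<close>

text \<open>A common prime factor cannot divide \<open>b\<close>, yet it divides the difference
  \<open>b * (j - i)\<close>, hence \<open>j - i\<close>, hence \<open>fact n\<close>, hence
  \<open>b\<close>.\<close>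

lemma coprime_godel_moduli:
  fixes b i j n :: nat
  assumes "i < j" "j \<le> n" "fact n dvd b"
  shows "coprime (1 + b * (i + 2)) (1 + b * (j + 2))"
proof (rule ccontr)
  assume "\<not> coprime (1 + b * (i + 2)) (1 + b * (j + 2))"
  then obtain p where p: "prime p" and "p dvd gcd (1 + b * (i + 2)) (1 + b * (j + 2))"
    using prime_factor_nat unfolding coprime_iff_gcd_eq_1 by blast
  then have p_dvd: "p dvd 1 + b * (i + 2)" "p dvd 1 + b * (j + 2)"
    using dvd_trans gcd_dvd1 gcd_dvd2 by blast+
  have nb: "\<not> p dvd b"
  proof
    assume "p dvd b"
    then have "p dvd b * (i + 2)" by (rule dvd_mult2)
    then have "p dvd 1" using p_dvd(1) dvd_add_left_iff by blast
    then show False using p not_prime_unit by blast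
  qed
  have "p dvd (1 + b * (j + 2)) - (1 + b * (i + 2))" using p_dvd by (intro dvd_diff_nat)
  also have "(1 + b * (j + 2)) - (1 + b * (i + 2)) = b * (j - i)"
    using assms(1) by (simp add: diff_mult_distrib2)
  finally have "p dvd j - i" using p nb by (simp add: prime_dvd_mult_iff)
  moreover have "j - i dvd fact n" using assms(1,2) by (intro dvd_fact) auto
  ultimately have "p dvd fact n" by (rule dvd_trans)
  then show False using nb assms(3) by (blast intro: dvd_trans)
qed

lemma godel_beta_surj:
  fixes c :: "nat \<Rightarrow> int"
  shows "\<exists>a b. b \<ge> 0 \<and> (\<forall>i\<le>n. godel_beta a b (int i) = c i)"
proof -
  define M where "M = (\<Sum>i\<le>n. nat \<bar>c i\<bar>)"
  \<comment> \<open>The factor \<open>fact n\<close> makes the moduli coprime, and the factor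
    \<open>M\<close> bounds all the values \<open>c i\<close> in absolute value.\<close>
  define b where "b = fact n * M"
  define m where "m i = 1 + b * (i + 2)" for i
  have cb: "\<bar>c i\<bar> \<le> int b" if "i \<le> n" for i
  proof -
    have "nat \<bar>c i\<bar> \<le> M" unfolding M_def using that by (intro member_le_sum) auto
    also have "M \<le> b" unfolding b_def by simp
    finally show ?thesis by linarith
  qed
  have "coprime (m i) (m j)" if "i \<le> n" "j \<le> n" "i \<noteq> j" for i j
    using that coprime_godel_moduli[of i j n b] coprime_godel_moduli[of j i n b]
    by (cases i j rule: linorder_cases) (auto simp: m_def b_def coprime_commute)
  then obtain a where a: "\<And>i. i \<le> n \<Longrightarrow> [a = nat (c i + int b)] (mod m i)"
    using chinese_remainder_nat[of "{..n}" m "\<lambda>i. nat (c i + int b)"] by auto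
  have "godel_beta (int a) (int b) (int i) = c i" if "i \<le> n" for i
  proof -
    have *: "nat (c i + int b) < m i" using cb[OF that] by (auto simp: m_def)
    have "a mod m i = nat (c i + int b)"
      using a[OF that] * by (simp add: cong_def)
    then have "int a mod int (m i) = c i + int b"
      using cb[OF that] by (simp flip: zmod_int)
    then show ?thesis by (simp add: godel_beta_def m_def algebra_simps)
  qed
  then show ?thesis by (intro exI[of _ "int a"] exI[of _ "int b"]) auto
qed

section \<open>Coefficient sequences and Horner evaluation\<close>

text \<open>The leading coefficient is \<open>g 0\<close>.\<close>

fun horner :: "(nat \<Rightarrow> int) \<Rightarrow> nat \<Rightarrow> int poly" where
  "horner g 0 = [:g 0:]"
| "horner g (Suc n) = pCons (g (Suc n)) (horner g n)"

lemma horner_cong: "(\<And>i. i \<le> n \<Longrightarrow> g i = h i) \<Longrightarrow> horner g n = horner h n"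
  by (induction n) auto

lemma horner_surj: "degree f \<le> n \<Longrightarrow> \<exists>g. horner g n = f"
proof (induction n arbitrary: f)
  case 0
  then obtain a where "f = [:a:]" by (auto elim: degree_eq_zeroE)
  then show ?case by (intro exI[of _ "\<lambda>_. a"]) simp
next
  case (Suc n)
  obtain a f' where f: "f = pCons a f'" by (cases f)
  have "degree f' \<le> n" using Suc.prems by (cases "f' = 0") (auto simp: f)
  then obtain g where g: "horner g n = f'" using Suc.IH by blast
  have "horner (g(Suc n := a)) n = horner g n" by (rule horner_cong) auto
  then show ?case using g f by (intro exI[of _ "g(Suc n := a)"]) (simp del: fun_upd_apply, simp)
qed

definition coded_poly :: "int \<Rightarrow> int \<Rightarrow> int \<Rightarrow> int poly" where
  "coded_poly a b d = horner (\<lambda>i. godel_beta a b (int i)) (nat d)"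

lemma coded_poly_surj: "\<exists>a b d. b \<ge> 0 \<and> d \<ge> 0 \<and> coded_poly a b d = f"
proof -
  obtain g where g: "horner g (degree f) = f" using horner_surj by blast
  obtain a b where ab: "b \<ge> 0" "\<forall>i\<le>degree f. godel_beta a b (int i) = g i"
    using godel_beta_surj by blast
  have "coded_poly a b (int (degree f)) = horner g (degree f)"
    unfolding coded_poly_def nat_int by (rule horner_cong) (use ab in auto)
  with ab(1) g show ?thesis by (metis of_nat_0_le_iff)
qed

text \<open>The pair \<open>a'\<close>, \<open>b'\<close> codes the intermediate results of Horner's
  scheme at \<open>n\<close>, so the recursion becomes a single existential statement with a bounded
  quantifier over the steps.\<close>

lemma poly_coded_poly_iff:
  assumes "d \<ge> 0"
  shows "poly (coded_poly a b d) n = v \<longleftrightarrow>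
    (\<exists>a' b'. b' \<ge> 0 \<and> godel_beta a' b' 0 = godel_beta a b 0 \<and> godel_beta a' b' d = v \<and>
      (\<forall>i. 0 \<le> i \<and> i < d \<longrightarrow>
        godel_beta a' b' (i + 1) = godel_beta a' b' i * n + godel_beta a b (i + 1)))" (is "?l \<longleftrightarrow> ?r")
proof
  define g where "g = (\<lambda>i. godel_beta a b (int i))"
  define s where "s i = poly (horner g i) n" for i
  have s: "s 0 = g 0" "\<And>i. s (Suc i) = s i * n + g (Suc i)"
    by (simp_all add: s_def)
  have cp: "poly (coded_poly a b d) n = s (nat d)"
    by (simp add: coded_poly_def s_def g_def)
  show ?r if ?l
  proof -
    obtain a' b' where b': "b' \<ge> 0" and *: "\<And>i. i \<le> nat d \<Longrightarrow> godel_beta a' b' (int i) = s i"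
      using godel_beta_surj[of "nat d" s] by blast
    have "godel_beta a' b' (i + 1) = godel_beta a' b' i * n + godel_beta a b (i + 1)"
      if "0 \<le> i" "i < d" for i
      using *[of "nat i"] *[of "Suc (nat i)"] s(2)[of "nat i"] that by (simp add: g_def add.commute)
    then show ?thesis
      using *[of 0] *[of "nat d"] s(1) b' \<open>?l\<close> assms by (intro exI[of _ a'] exI[of _ b']) (simp add: cp g_def)
  qed
  show ?l if ?r
  proof -
    obtain a' b' where *: "godel_beta a' b' 0 = godel_beta a b 0" "godel_beta a' b' d = v"
      "\<And>i. 0 \<le> i \<and> i < d \<Longrightarrow>
        godel_beta a' b' (i + 1) = godel_beta a' b' i * n + godel_beta a b (i + 1)"
      using \<open>?r\<close> by blast
    have "godel_beta a' b' (int i) = s i" if "int i \<le> d" for i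
      using that
    proof (induction i)
      case 0
      then show ?case using *(1) s(1) by (simp add: g_def)
    next
      case (Suc i)
      then show ?case using *(3)[of "int i"] s(2)[of i] by (simp add: g_def add.commute)
    qed
    from this[of "nat d"] show ?thesis using * assms by (simp add: cp)
  qed
qed

section \<open>The polynomial ring inside the integers\<close>

lemma class_ring_simps [simp]:
  "carrier class_ring = UNIV" "\<zero>\<^bsub>class_ring\<^esub> = 0" "\<one>\<^bsub>class_ring\<^esub> = 1"
  "x \<oplus>\<^bsub>class_ring\<^esub> y = x + y" "x \<otimes>\<^bsub>class_ring\<^esub> y = x * y"
  by (simp_all add: class_ring_def)

lemma closed_struct_class_ring: "closed_struct class_ring"
  by (simp add: closed_struct_def)

lemma tuples_class_ring: "u \<in> tuples class_ring n \<longleftrightarrow> length u = n"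
  by (simp add: tuples_def)

section \<open>Formulas for order, beta function and evaluation\<close>

definition nonneg_fm :: fm where
  "nonneg_fm = Ex (Ex (Ex (Ex (Ex (Conj (Neg (Eq (Var 4) TZero))
     (Eq (TMul (TMul (Var 5) (Var 4)) (Var 4))
       (TAdd (TAdd (TAdd (TMul (Var 3) (Var 3)) (TMul (Var 2) (Var 2)))
         (TMul (Var 1) (Var 1))) (TMul (Var 0) (Var 0)))))))))"

lemma wf_nonneg: "wf_fm 1 nonneg_fm"
  by (simp add: nonneg_fm_def)

lemma sat_nonneg: "sat class_ring [x] nonneg_fm \<longleftrightarrow> (0 :: int) \<le> x"
  by (simp add: nonneg_fm_def nonneg_iff_scaled_four_squares scaled_four_squares_def)

lemma sat_inst_nonneg [simp]:
  "sat class_ring e (inst nonneg_fm [i]) \<longleftrightarrow> (0 :: int) \<le> e ! i"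
  using wf_nonneg by (simp add: sat_inst sat_nonneg)

lemma wf_inst_nonneg [simp]: "i < N \<Longrightarrow> wf_fm N (inst nonneg_fm [i])"
  using wf_nonneg by (auto intro: wf_inst)

text \<open>\<open>Var 2\<close>, \<open>Var 1\<close> and \<open>Var 0\<close> are the remainder, a
  slack and the quotient; \<open>Var 3\<close> to \<open>Var 6\<close> are \<open>a\<close>,
  \<open>b\<close>, the index and the value. The slack expresses that the remainder is smaller than
  the modulus.\<close>

definition beta_fm :: fm where
  "beta_fm = Ex (Ex (Ex (conjs [inst nonneg_fm [2], inst nonneg_fm [1],
     Eq (Var 2) (TAdd (Var 6) (Var 4)),
     Eq (TMul (Var 4) (TAdd (TAdd (Var 5) TOne) TOne)) (TAdd (Var 2) (Var 1)),
     Eq (Var 3) (TAdd (TMul (TAdd TOne (TMul (Var 4) (TAdd (TAdd (Var 5) TOne) TOne))) (Var 0))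
       (Var 2))])))"

lemma wf_beta: "wf_fm 4 beta_fm"
  by (simp add: beta_fm_def)

lemma godel_beta_eq_iff:
  assumes "0 \<le> b" "0 \<le> i"
  shows "godel_beta a b i = s \<longleftrightarrow> (\<exists>r k q. 0 \<le> r \<and> 0 \<le> k \<and> r = s + b \<and> b * (i + 1 + 1) = r + k \<and>
    a = (1 + b * (i + 1 + 1)) * q + r)"
proof -
  define m where "m = 1 + b * (i + 2)"
  have m: "m > 0" using assms by (simp add: m_def add_pos_nonneg)
  have "a mod m = r \<longleftrightarrow> 0 \<le> r \<and> r < m \<and> (\<exists>q. a = m * q + r)" for r
  proof
    assume "a mod m = r"
    then show "0 \<le> r \<and> r < m \<and> (\<exists>q. a = m * q + r)"
      using m by (auto intro: exI[of _ "a div m"])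
  qed auto
  moreover have "godel_beta a b i = s \<longleftrightarrow> a mod m = s + b"
    by (auto simp: godel_beta_def m_def)
  moreover have "s + b < m \<longleftrightarrow> (\<exists>k. 0 \<le> k \<and> b * (i + 1 + 1) = s + b + k)"
    by (auto simp: m_def algebra_simps intro: exI[of _ "b * (i + 2) - (s + b)"])
  moreover have "m = 1 + b * (i + 1 + 1)" by (simp add: m_def)
  ultimately show ?thesis by auto
qed

lemma sat_inst_beta [simp]:
  assumes "0 \<le> e ! b" "0 \<le> e ! i"
  shows "sat class_ring e (inst beta_fm [a, b, i, s]) \<longleftrightarrow> godel_beta (e ! a) (e ! b) (e ! i) = e ! s"
  using wf_beta by (simp add: sat_inst sat_conjs beta_fm_def godel_beta_eq_iff[OF assms] eval_nat_numeral)

lemma wf_inst_beta [simp]: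
  "a < N \<Longrightarrow> b < N \<Longrightarrow> i < N \<Longrightarrow> s < N \<Longrightarrow> wf_fm N (inst beta_fm [a, b, i, s])"
  using wf_beta by (auto intro!: wf_inst simp: eval_nat_numeral)

text \<open>The two outer quantifiers bind the code of the Horner results. The next pair compares
  both sequences at index 0. In the innermost block \<open>Var 4\<close> is the step i and
  \<open>Var 3\<close> its successor, \<open>Var 2\<close> and \<open>Var 1\<close> are the results
  after and before the step, and \<open>Var 0\<close> is the coefficient used.\<close>

definition eval_fm :: fm where
  "eval_fm = Ex (Ex (conjs [inst nonneg_fm [0],
     Ex (Ex (conjs [Eq (Var 1) TZero, inst beta_fm [4, 5, 1, 0], inst beta_fm [3, 2, 1, 0]])),
     inst beta_fm [1, 0, 4, 6],
     Forall (Implies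
       (Conj (inst nonneg_fm [0])
         (Ex (Conj (inst nonneg_fm [0]) (Eq (Var 6) (TAdd (TAdd (Var 1) TOne) (Var 0))))))
       (Ex (Ex (Ex (Ex (conjs [Eq (Var 3) (TAdd (Var 4) TOne),
         inst beta_fm [6, 5, 3, 2], inst beta_fm [6, 5, 4, 1], inst beta_fm [7, 8, 3, 0],
         Eq (Var 2) (TAdd (TMul (Var 1) (Var 10)) (Var 0))]))))))]))"

lemma wf_eval: "wf_fm 5 eval_fm"
  by (simp add: eval_fm_def)

lemma sat_eval:
  assumes "0 \<le> b" "0 \<le> d"
  shows "sat class_ring [a, b, d, n, v] eval_fm \<longleftrightarrow> poly (coded_poly a b d) n = v"
proof -
  have lt: "(\<exists>k. 0 \<le> k \<and> d = i + 1 + k) \<longleftrightarrow> i < d" for i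
    by (auto intro: exI[of _ "d - i - 1"])
  show ?thesis
    unfolding poly_coded_poly_iff[OF assms(2)]
    using assms by (simp add: eval_fm_def sat_conjs lt cong: conj_cong)
qed

lemma sat_inst_eval [simp]:
  assumes "0 \<le> e ! b" "0 \<le> e ! d"
  shows "sat class_ring e (inst eval_fm [a, b, d, n, v]) \<longleftrightarrow>
    poly (coded_poly (e ! a) (e ! b) (e ! d)) (e ! n) = e ! v"
  using wf_eval assms by (simp add: sat_inst sat_eval eval_nat_numeral)

lemma wf_inst_eval [simp]:
  "a < N \<Longrightarrow> b < N \<Longrightarrow> d < N \<Longrightarrow> n < N \<Longrightarrow> v < N \<Longrightarrow> wf_fm N (inst eval_fm [a, b, d, n, v])"
  using wf_eval by (auto intro!: wf_inst simp: eval_nat_numeral)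

text \<open>The triple consists of the two beta numbers of the coefficients and a degree bound. The
  universally quantified variable is the argument at which the coded polynomials are compared; the
  existential ones are their values there.\<close>

definition poly_code :: code where
  "poly_code = \<lparr>cdim = 3, cpar = 0,
     cdom = Conj (inst nonneg_fm [1]) (inst nonneg_fm [2]),
     ceq = Forall (Ex (Conj (inst eval_fm [2, 3, 4, 1, 0]) (inst eval_fm [5, 6, 7, 1, 0]))),
     czero = Forall (Ex (Conj (Eq (Var 0) TZero) (inst eval_fm [2, 3, 4, 1, 0]))),
     cone = Forall (Ex (Conj (Eq (Var 0) TOne) (inst eval_fm [2, 3, 4, 1, 0]))),
     cadd = Forall (Ex (Ex (Ex (conjs [inst eval_fm [4, 5, 6, 3, 2], inst eval_fm [7, 8, 9, 3, 1],
       inst eval_fm [10, 11, 12, 3, 0], Eq (Var 0) (TAdd (Var 2) (Var 1))])))),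
     cmul = Forall (Ex (Ex (Ex (conjs [inst eval_fm [4, 5, 6, 3, 2], inst eval_fm [7, 8, 9, 3, 1],
       inst eval_fm [10, 11, 12, 3, 0], Eq (Var 0) (TMul (Var 2) (Var 1))]))))\<rparr>"

lemma wf_poly_code: "wf_code poly_code"
  by (simp add: wf_code_def poly_code_def)

lemma poly_code_dims [simp]: "cdim poly_code = 3" "cpar poly_code = 0"
  by (simp_all add: poly_code_def)

definition poly_of_code :: "int list \<Rightarrow> int poly" where
  "poly_of_code u = coded_poly (u ! 0) (u ! 1) (u ! 2)"

lemma dom_set_poly_code:
  "dom_set poly_code class_ring [] = {[a, b, d] | a b d :: int. 0 \<le> b \<and> 0 \<le> d}"
  by (auto simp: dom_set_def poly_code_def tuples_class_ring numeral_3_eq_3 length_Suc_conv)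

lemma coordinatization_poly_code:
  "coordinatization poly_code (class_ring :: int ring) [] class_ring poly_of_code"
proof -
  have eq: "f = g \<longleftrightarrow> (\<forall>n. poly f n = poly g n)" for f g :: "int poly"
    unfolding poly_eq_poly_eq_iff[symmetric] fun_eq_iff ..
  have "poly_of_code ` dom_set poly_code class_ring [] = UNIV"
  proof safe
    fix f :: "int poly"
    obtain a b d where "b \<ge> 0" "d \<ge> 0" "coded_poly a b d = f" using coded_poly_surj by blast
    then show "f \<in> poly_of_code ` dom_set poly_code class_ring []"
      unfolding dom_set_poly_code by (intro image_eqI[of _ _ "[a, b, d]"]) (auto simp: poly_of_code_def)
  qed simp
  then show ?thesis
    unfolding coordinatization_def
    by (auto simp: closed_struct_class_ring dom_set_poly_code poly_of_code_def eq)
      (auto simp: poly_code_def sat_conjs)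
qed

section \<open>The Pell equation over the integer polynomials\<close>

text \<open>With \<open>r\<^sup>2 = t\<^sup>2 - 1\<close>, the solution \<open>X' + Y' r\<close> is the product of \<open>s X + Y r\<close> and \<open>t - r\<close>;
  \<open>s\<close> is the sign for which the degree drops.\<close>

lemma pell_descent:
  fixes t X Y s n e :: "int poly"
  assumes "X * X + Y * Y = t * t * Y * Y + 1" "s * s = 1"
  defines "X' \<equiv> s * t * X - (t * t - 1) * Y" and "Y' \<equiv> t * Y - s * X"
  shows "X' * X' + Y' * Y' = t * t * Y' * Y' + 1"
    and "t - 1 dvd X' - e \<Longrightarrow> t - 1 dvd X - s * e"
    and "t - 1 dvd X' - e \<Longrightarrow> t - 1 dvd Y' - n \<Longrightarrow> t - 1 dvd Y - (n + e)"
proof -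
  show "X' * X' + Y' * Y' = t * t * Y' * Y' + 1"
    using assms(1,2) unfolding X'_def Y'_def by Groebner_Basis.algebra
  \<comment> \<open>Modulo \<open>t - 1\<close> one may set \<open>t = 1\<close>: then
    \<open>X'\<close> becomes \<open>s * X\<close> and \<open>Y'\<close> becomes
    \<open>Y - s * X\<close>.\<close>
  have X': "X' - s * X = (t - 1) * (s * X - (t + 1) * Y)"
    unfolding X'_def by (simp add: algebra_simps)
  have Y': "Y' - (Y - s * X) = (t - 1) * Y"
    unfolding Y'_def by (simp add: algebra_simps)
  {
    assume "t - 1 dvd X' - e"
    then obtain A where A: "X' - e = (t - 1) * A" by (elim dvdE)
    have "X - s * e = (t - 1) * (s * A - s * (s * X - (t + 1) * Y))"
      using A X' assms(2) by Groebner_Basis.algebra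
    then show "t - 1 dvd X - s * e" by simp
    assume "t - 1 dvd Y' - n"
    then obtain B where B: "Y' - n = (t - 1) * B" by (elim dvdE)
    have "Y - (n + e) = (t - 1) * (B - Y + A - (s * X - (t + 1) * Y))"
      using A B X' Y' by Groebner_Basis.algebra
    then show "t - 1 dvd Y - (n + e)" by simp
  }
qed

lemma square_eq_1_poly: "Y * Y = 1 \<Longrightarrow> Y = 1 \<or> Y = (-1 :: int poly)"
  using square_eq_1_iff[of Y] by simp

text \<open>Descent on the degree of \<open>Y\<close>. The factors \<open>t * Y - X\<close> and
  \<open>t * Y + X\<close> have product \<open>Y * Y - 1\<close>, of degree at most twice that of
  \<open>Y\<close>, while their sum has larger degree than \<open>Y\<close>. So one factor exceeds
  \<open>Y\<close> in degree and the other falls below it.\<close>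

lemma pell_cong_const:
  fixes t X Y :: "int poly"
  assumes "degree t > 0" "X * X + Y * Y = t * t * Y * Y + 1"
  shows "\<exists>e n. t - 1 dvd X - [:e:] \<and> t - 1 dvd Y - [:n:]"
  using assms(2)
proof (induction "degree Y" arbitrary: X Y rule: less_induct)
  case less
  have eq: "(t * Y - X) * (t * Y + X) = Y * Y - 1"
    using less.prems by Groebner_Basis.algebra
  have const: "\<exists>k. Z = [:k:]" if "Z * Z = 1" for Z :: "int poly"
    using square_eq_1_poly[OF that] by (metis one_pCons minus_pCons minus_zero)
  \<comment> \<open>The degree count needs both \<open>Y\<close> and \<open>Y * Y - 1\<close>
    nonzero. Where it fails, \<open>X\<close> is a constant unit or \<open>X\<close> is
    \<open>t * Y\<close> up to sign with \<open>Y\<close> a unit.\<close>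
  consider "Y = 0" | "Y * Y = 1" | "Y \<noteq> 0" "Y * Y \<noteq> 1" by blast
  then show ?case
  proof cases
    case 1
    then obtain k where "X = [:k:]" using less.prems const[of X] by auto
    with 1 show ?thesis by (intro exI[of _ k] exI[of _ 0]) simp
  next
    case 2
    then obtain k where k: "Y = [:k:]" using const by blast
    have "X = t * Y \<or> X = - (t * Y)" using eq 2 by (auto simp: eq_neg_iff_add_eq_0 add.commute)
    moreover have "[:- k:] = - Y" by (simp add: k)
    then have "t * Y - [:k:] = (t - 1) * Y" "- (t * Y) - [:- k:] = (t - 1) * (- Y)"
      unfolding k[symmetric] by (simp_all add: algebra_simps)
    ultimately have "t - 1 dvd X - [:k:] \<or> t - 1 dvd X - [:- k:]" by (metis dvd_triv_left)
    moreover have "t - 1 dvd Y - [:k:]" by (simp add: k)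
    ultimately show ?thesis by blast
  next
    case 3
    then have "Y * Y - 1 \<noteq> 0" by simp
    then have nz: "t * Y - X \<noteq> 0" "t * Y + X \<noteq> 0" using eq by auto
    have t0: "t \<noteq> 0" using assms(1) by auto
    have "degree (t * Y - X) + degree (t * Y + X) = degree (Y * Y - 1)"
      using nz by (simp flip: eq add: degree_mult_eq)
    also have "\<dots> \<le> 2 * degree Y"
      using 3 by (intro degree_diff_le) (simp_all add: degree_mult_eq)
    finally have sum: "degree (t * Y - X) + degree (t * Y + X) \<le> 2 * degree Y" .
    have "degree t + degree Y = degree ((t * Y - X) + (t * Y + X))"
      using t0 3 by (simp add: degree_mult_eq flip: mult_2)
    also have "\<dots> \<le> max (degree (t * Y - X)) (degree (t * Y + X))"
      by (rule degree_add_le_max)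
    finally have "degree (t * Y - X) < degree Y \<or> degree (t * Y + X) < degree Y"
      using sum assms(1) by linarith
    then obtain s where s: "s * s = 1" "degree (t * Y - s * X) < degree Y"
      by (metis diff_minus_eq_add minus_mult_left mult_1 mult_minus_left mult_minus_right minus_minus)
    from less.hyps[OF s(2) pell_descent(1)[OF less.prems s(1)]]
    obtain e n where en: "t - 1 dvd (s * t * X - (t * t - 1) * Y) - [:e:]" "t - 1 dvd t * Y - s * X - [:n:]"
      by blast
    obtain k where k: "s = [:k:]" using const[OF s(1)] by blast
    \<comment> \<open>Undoing the descent multiplies the residue of \<open>X\<close> by the sign and
      adds the residue of the smaller \<open>X\<close> to that of \<open>Y\<close>.\<close>
    have "t - 1 dvd X - [:k * e:]" "t - 1 dvd Y - [:n + e:]"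
      using pell_descent(2)[OF less.prems s(1) en(1)] pell_descent(3)[OF less.prems s(1) en]
      by (simp_all add: k mult.commute)
    then show ?thesis by blast
  qed
qed

text \<open>Powers of \<open>t + r\<close> with \<open>r * r = t * t - 1\<close>: multiplication by
  \<open>t + r\<close> keeps \<open>X\<close> congruent to 1 modulo \<open>t - 1\<close> and so
  raises the residue of \<open>Y\<close> by 1.\<close>

lemma ex_pell_cong_nat:
  "\<exists>X Y. X * X + Y * Y = t * t * Y * Y + 1 \<and> t - 1 dvd X - 1 \<and> t - 1 dvd Y - of_nat n"
  for t :: "'a :: idom"
proof (induction n)
  case 0
  show ?case by (intro exI[of _ 1] exI[of _ 0]) simp
next
  case (Suc n)
  then obtain X Y where XY: "X * X + Y * Y = t * t * Y * Y + 1" "t - 1 dvd X - 1" "t - 1 dvd Y - of_nat n"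
    by blast
  define X' Y' where "X' = t * X + (t * t - 1) * Y" and "Y' = X + t * Y"
  have "X' * X' + Y' * Y' = t * t * Y' * Y' + 1"
    using XY(1) unfolding X'_def Y'_def by Groebner_Basis.algebra
  moreover have "X' - 1 = (t - 1) * (X + (t + 1) * Y) + (X - 1)"
    and "Y' - of_nat (Suc n) = (t - 1) * Y + ((X - 1) + (Y - of_nat n))"
    unfolding X'_def Y'_def by (simp_all add: algebra_simps)
  then have "t - 1 dvd X' - 1" "t - 1 dvd Y' - of_nat (Suc n)"
    using XY(2,3) by (metis dvd_add dvd_triv_left)+
  ultimately show ?case by blast
qed

text \<open>The equation with \<open>W\<close> says that \<open>t - 1\<close> divides \<open>Y - c\<close>, without subtraction.\<close>

lemma const_poly_iff_pell:
  fixes c :: "int poly"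
  shows "(\<exists>k. c = [:k:]) \<longleftrightarrow>
    (\<forall>t. \<exists>X Y W. X * X + Y * Y = t * t * Y * Y + 1 \<and> Y + W = c + t * W)" (is "?l \<longleftrightarrow> ?r")
proof
  assume ?l
  then obtain k where k: "c = [:k:]" by blast
  show ?r
  proof
    fix t :: "int poly"
    obtain X Y where XY: "X * X + Y * Y = t * t * Y * Y + 1" "t - 1 dvd Y - of_nat (nat \<bar>k\<bar>)"
      using ex_pell_cong_nat[of t "nat \<bar>k\<bar>"] by blast
    have "of_nat (nat \<bar>k\<bar>) = [:\<bar>k\<bar>:]" by (simp only: of_nat_poly) simp
    with XY(2) have Y: "t - 1 dvd Y - [:\<bar>k\<bar>:]" by (simp only:)
    \<comment> \<open>Negative constants are reached by changing the sign of \<open>Y\<close>, which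
      occurs in the Pell equation only squared.\<close>
    obtain Z where Z: "Z * Z = Y * Y" "t - 1 dvd Z - c"
    proof (cases "k \<ge> 0")
      case True
      then show ?thesis using that[of Y] Y by (simp add: k)
    next
      case False
      have "- Y - c = - (Y - [:\<bar>k\<bar>:])" using False by (simp add: k)
      then show ?thesis using that[of "- Y"] Y by (metis dvd_minus_iff minus_mult_minus)
    qed
    then obtain W where "Z - c = (t - 1) * W" by (elim dvdE)
    then have "Z + W = c + t * W" by Groebner_Basis.algebra
    moreover have "X * X + Z * Z = t * t * Z * Z + 1" using XY(1) Z(1) by Groebner_Basis.algebra
    ultimately show "\<exists>X Y W. X * X + Y * Y = t * t * Y * Y + 1 \<and> Y + W = c + t * W" by blast
  qed
next
  assume r: ?r
  \<comment> \<open>Any \<open>t\<close> of larger degree than \<open>c\<close> would do: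
    \<open>t - 1\<close> then divides \<open>c - [:n:]\<close>, whose degree is too small unless it
    is zero.\<close>
  define t :: "int poly" where "t = monom 1 (Suc (degree c))"
  have dt: "degree t = Suc (degree c)" by (simp add: t_def degree_monom_eq)
  obtain X Y W where XY: "X * X + Y * Y = t * t * Y * Y + 1" and W: "Y + W = c + t * W"
    using r by blast
  obtain n where n: "t - 1 dvd Y - [:n:]" using pell_cong_const[OF _ XY] dt by auto
  have "c - [:n:] = (Y - [:n:]) - (t - 1) * W" using W by Groebner_Basis.algebra
  then have dvd: "t - 1 dvd c - [:n:]" using n by (metis dvd_diff dvd_triv_left)
  have "degree (t - 1) = Suc (degree c)"
    using degree_add_eq_left[of "- 1" t] dt by simp
  moreover have "degree (c - [:n:]) \<le> degree c" by (intro degree_diff_le) auto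
  ultimately have "c - [:n:] = 0" using dvd_imp_degree_le[OF dvd] by linarith
  then show ?l by auto
qed

section \<open>Linear polynomials and substitution\<close>

text \<open>Taking the indeterminate for \<open>f\<close> shows that \<open>t\<close> divides a
  monic polynomial of degree 1. As \<open>t\<close> is not constant, the cofactor is, and it is
  inverse to the leading coefficient of \<open>t\<close>.\<close>

lemma linear_of_const_residues:
  fixes t :: "int poly"
  assumes "\<And>f. \<exists>k g. f = [:k:] + t * g" and "\<And>k. t \<noteq> [:k:]"
  shows "\<exists>k s. t = [:k, s:] \<and> s * s = 1"
proof -
  obtain k g where g: "[:0, 1:] = [:k:] + t * g" using assms(1) by blast
  then have tg: "t * g = [:- k, 1:]" by (metis add_diff_cancel_left' diff_0 diff_pCons diff_zero)
  then have nz: "t \<noteq> 0" "g \<noteq> 0" by auto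
  have "degree t + degree g = 1" using degree_mult_eq[OF nz] tg by simp
  moreover have "degree t \<noteq> 0" using assms(2) by (metis degree_eq_zeroE)
  ultimately have d: "degree t = 1" "degree g = 0" by auto
  obtain c where c: "g = [:c:]" using d(2) by (auto elim: degree_eq_zeroE)
  obtain a t' where t': "t = pCons a t'" by (cases t)
  then have "degree t' = 0" using d(1) by (simp split: if_splits)
  then obtain s where t: "t = [:a, s:]" using t' by (auto elim: degree_eq_zeroE)
  have "c * s = 1" using tg by (simp add: c t)
  then have "s * s = 1" using zmult_eq_1_iff by auto
  with t show ?thesis by blast
qed

text \<open>Since \<open>s\<close> is its own inverse, substituting \<open>[:- (k * s), s:]\<close>
  undoes the substitution.\<close>

lemma bij_pcompose_linear:
  fixes k s :: int
  assumes "s * s = 1"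
  shows "bij (\<lambda>f. pcompose f [:k, s:])"
proof (rule bijI')
  have id: "pcompose [:k, s:] [:- (k * s), s:] = [:0, 1:]" "pcompose [:- (k * s), s:] [:k, s:] = [:0, 1:]"
    using assms by (simp_all add: pcompose_pCons algebra_simps)
  show "pcompose f [:k, s:] = pcompose g [:k, s:] \<longleftrightarrow> f = g" for f g
    using id(1) by (metis pcompose_assoc pcompose_idR)
  show "\<exists>f. g = pcompose f [:k, s:]" for g
    using id(2) by (metis pcompose_assoc pcompose_idR)
qed

text \<open>The right side says, without subtraction, that \<open>t - n\<close> divides
  \<open>f - F(n)\<close> for every integer \<open>n\<close>, where \<open>t\<close> is
  \<open>[:k, s:]\<close>. It follows from the factor theorem for \<open>F\<close> by substitution
  of \<open>t\<close>.\<close>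

lemma eq_pcompose_linear_iff:
  fixes f F :: "int poly"
  assumes "s * s = 1"
  shows "f = pcompose F [:k, s:] \<longleftrightarrow>
    (\<forall>n v. poly F n = v \<longrightarrow> (\<exists>g. f + [:n:] * g = [:v:] + [:k, s:] * g))" (is "?l \<longleftrightarrow> ?r")
proof
  assume l: ?l
  show ?r
  proof (intro allI impI)
    fix n v assume "poly F n = v"
    then have "poly (F - [:v:]) n = 0" by simp
    then obtain h where h: "F - [:v:] = [:- n, 1:] * h" unfolding poly_eq_0_iff_dvd by (elim dvdE)
    have "f - [:v:] = pcompose (F - [:v:]) [:k, s:]" by (simp add: l pcompose_diff)
    also have "\<dots> = pcompose [:- n, 1:] [:k, s:] * pcompose h [:k, s:]"
      unfolding h by (rule pcompose_mult)
    also have "pcompose [:- n, 1:] [:k, s:] = [:k, s:] - [:n:]" by (simp add: pcompose_pCons)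
    finally have "f - [:v:] = ([:k, s:] - [:n:]) * pcompose h [:k, s:]" .
    then have "f + [:n:] * pcompose h [:k, s:] = [:v:] + [:k, s:] * pcompose h [:k, s:]" by Groebner_Basis.algebra
    then show "\<exists>g. f + [:n:] * g = [:v:] + [:k, s:] * g" by blast
  qed
next
  assume r: ?r
  have "poly f x = poly (pcompose F [:k, s:]) x" for x
  proof -
    \<comment> \<open>The integer \<open>n\<close> is chosen as the value of \<open>t\<close> at
      \<open>x\<close>, so that the terms with \<open>g\<close> cancel at \<open>x\<close>, whatever
      \<open>g\<close> is.\<close>
    obtain g where g: "f + [:k + s * x:] * g = [:poly F (k + s * x):] + [:k, s:] * g" using r by blast
    have "poly (f + [:k + s * x:] * g) x = poly ([:poly F (k + s * x):] + [:k, s:] * g) x"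
      unfolding g ..
    then show ?thesis by (simp add: poly_pcompose algebra_simps)
  qed
  then show ?l unfolding poly_eq_poly_eq_iff[symmetric] by (simp add: fun_eq_iff)
qed

section \<open>The integers inside the polynomial ring\<close>

text \<open>The Pell condition of \<open>const_poly_iff_pell\<close>, with \<open>Var 4\<close> for
  \<open>c\<close>, \<open>Var 3\<close> for \<open>t\<close>, and \<open>Var 2\<close>,
  \<open>Var 1\<close>, \<open>Var 0\<close> for \<open>X\<close>, \<open>Y\<close>,
  \<open>W\<close>.\<close>

definition const_fm :: fm where
  "const_fm = Forall (Ex (Ex (Ex (Conj
     (Eq (TAdd (TMul (Var 2) (Var 2)) (TMul (Var 1) (Var 1)))
       (TAdd (TMul (TMul (TMul (Var 3) (Var 3)) (Var 1)) (Var 1)) TOne))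
     (Eq (TAdd (Var 1) (Var 0)) (TAdd (Var 4) (TMul (Var 3) (Var 0))))))))"

lemma wf_const: "wf_fm 1 const_fm"
  by (simp add: const_fm_def)

lemma sat_const: "sat class_ring [c] const_fm \<longleftrightarrow> (\<exists>k::int. c = [:k:])"
  unfolding const_poly_iff_pell by (simp add: const_fm_def)

lemma sat_inst_const [simp]:
  "sat class_ring e (inst const_fm [i]) \<longleftrightarrow> (\<exists>k::int. e ! i = [:k:])"
  using wf_const by (simp add: sat_inst sat_const)

lemma wf_inst_const [simp]: "i < N \<Longrightarrow> wf_fm N (inst const_fm [i])"
  using wf_const by (auto intro: wf_inst)

text \<open>Relativisation to the constants, a copy of the integers inside the polynomials. It
  transports the formulas for order and evaluation without building them again.\<close>

fun rel_const :: "fm \<Rightarrow> fm" where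
  "rel_const (Eq s t) = Eq s t"
| "rel_const (Neg \<phi>) = Neg (rel_const \<phi>)"
| "rel_const (Conj \<phi> \<psi>) = Conj (rel_const \<phi>) (rel_const \<psi>)"
| "rel_const (Ex \<phi>) = Ex (Conj (inst const_fm [0]) (rel_const \<phi>))"

lemma wf_rel_const: "wf_fm N \<phi> \<Longrightarrow> wf_fm N (rel_const \<phi>)"
  by (induction \<phi> arbitrary: N) auto

lemma sat_rel_const:
  "wf_fm (length e) \<phi> \<Longrightarrow>
    sat class_ring (map (\<lambda>k. [:k:]) e) (rel_const \<phi>) \<longleftrightarrow> sat class_ring (e :: int list) \<phi>"
proof (induction \<phi> arbitrary: e)
  case (Eq s t)
  have "wf_tm (length e) u \<Longrightarrow> tm_val class_ring (map (\<lambda>k. [:k:]) e) u = [:tm_val class_ring e u:]" for u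
    by (induction u) auto
  with Eq show ?case by simp
next
  case (Ex \<phi>)
  have "sat class_ring ([:k:] # map (\<lambda>k. [:k:]) e) (rel_const \<phi>) \<longleftrightarrow> sat class_ring (k # e) \<phi>" for k
    using Ex.IH[of "k # e"] Ex.prems by simp
  then show ?case by auto
qed auto

definition int_code :: code where
  "int_code = \<lparr>cdim = 1, cpar = 1,
     cdom = inst const_fm [0], ceq = Eq (Var 0) (Var 1),
     czero = Eq (Var 0) TZero, cone = Eq (Var 0) TOne,
     cadd = Eq (Var 2) (TAdd (Var 0) (Var 1)), cmul = Eq (Var 2) (TMul (Var 0) (Var 1))\<rparr>"

lemma wf_int_code: "wf_code int_code"
  by (simp add: wf_code_def int_code_def)

lemma int_code_dims [simp]: "cdim int_code = 1" "cpar int_code = 1"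
  by (simp_all add: int_code_def)

definition int_of_code :: "int poly list \<Rightarrow> int" where
  "int_of_code u = coeff (u ! 0) 0"

lemma dom_set_int_code: "dom_set int_code class_ring [t] = {[[:k:]] | k :: int. True}"
  by (auto simp: dom_set_def int_code_def tuples_class_ring length_Suc_conv)

lemma coordinatization_int_code:
  "coordinatization int_code class_ring [t] class_ring int_of_code"
proof -
  have "int_of_code ` dom_set int_code class_ring [t] = UNIV"
    unfolding dom_set_int_code by (force simp: int_of_code_def)
  then show ?thesis
    unfolding coordinatization_def
    by (auto simp: closed_struct_class_ring dom_set_int_code int_of_code_def)
      (auto simp: int_code_def one_pCons)
qed

text \<open>Non-constancy of \<open>t\<close> together with the existence of a constant in every
  residue class modulo \<open>t\<close>; these two properties single out the polynomials of degree 1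
  with leading coefficient 1 or -1.\<close>

definition linear_fm :: fm where
  "linear_fm = Conj (Neg (inst const_fm [0]))
     (Forall (Ex (Ex (Conj (inst const_fm [1]) (Eq (Var 2) (TAdd (Var 1) (TMul (Var 3) (Var 0))))))))"

lemma wf_linear: "wf_fm 1 linear_fm"
  by (simp add: linear_fm_def)

lemma sat_linear: "sat class_ring [t] linear_fm \<longleftrightarrow> (\<exists>k s::int. t = [:k, s:] \<and> s * s = 1)"
proof -
  have iff: "sat class_ring [t] linear_fm \<longleftrightarrow>
      (\<forall>k::int. t \<noteq> [:k:]) \<and> (\<forall>f. \<exists>k g. f = [:k:] + t * g)"
    by (simp add: linear_fm_def) blast
  show ?thesis
  proof
    assume "sat class_ring [t] linear_fm"
    then show "\<exists>k s. t = [:k, s:] \<and> s * s = 1"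
      unfolding iff by (intro linear_of_const_residues) auto
  next
    assume "\<exists>k s. t = [:k, s:] \<and> s * s = 1"
    then obtain k s where t: "t = [:k, s:]" "s * s = 1" by blast
    have "\<exists>c g. f = [:c:] + t * g" for f
    proof -
      obtain F where F: "f = pcompose F t"
        using bij_pcompose_linear[OF t(2), of k] t(1) by (metis bij_pointE)
      \<comment> \<open>Written as a polynomial in \<open>t\<close>, any \<open>f\<close> has its
        constant term as residue modulo \<open>t\<close>.\<close>
      have "pcompose (pCons a F') t = [:a:] + t * pcompose F' t" for a F'
        by (simp add: pcompose_pCons)
      then show ?thesis unfolding F by (metis pCons_cases)
    qed
    then show "sat class_ring [t] linear_fm" unfolding iff using t by auto
  qed
qed

lemma solutions_linear:
  "solutions class_ring 1 linear_fm = {[[:k, s:]] | k s :: int. s * s = 1}"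
  by (auto simp: solutions_def tuples_class_ring length_Suc_conv sat_linear)

section \<open>The two interpretations and their definable coordinate maps\<close>

definition true_fm :: fm where "true_fm = Eq TZero TZero"

text \<open>The graph of substituting \<open>t\<close> into the polynomial coded by three constants,
  in the form of \<open>eq_pcompose_linear_iff\<close>. The two universal variables are the argument
  \<open>n\<close> and the value \<open>v\<close>.\<close>

definition poly_map_fm :: fm where
  "poly_map_fm = conjs [inst const_fm [0], inst const_fm [1], inst const_fm [2],
     inst (rel_const nonneg_fm) [1], inst (rel_const nonneg_fm) [2],
     Forall (Forall (Implies (conjs [inst const_fm [1], inst const_fm [0],
         inst (rel_const eval_fm) [2, 3, 4, 1, 0]])
       (Ex (Eq (TAdd (Var 6) (TMul (Var 2) (Var 0))) (TAdd (Var 1) (TMul (Var 7) (Var 0)))))))]"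

lemma wf_poly_map: "wf_fm 5 poly_map_fm"
  using wf_rel_const[OF wf_nonneg] wf_rel_const[OF wf_eval]
  by (auto simp: poly_map_fm_def eval_nat_numeral intro!: wf_inst)

lemma sat_poly_map:
  assumes "s * s = 1"
  shows "sat class_ring [u0, u1, u2, f, [:k, s:]] poly_map_fm \<longleftrightarrow>
    (\<exists>a b d. u0 = [:a:] \<and> u1 = [:b:] \<and> u2 = [:d:] \<and> 0 \<le> b \<and> 0 \<le> d \<and>
       f = pcompose (coded_poly a b d) [:k, s:])"
proof -
  have nn: "sat class_ring [[:x:]] (rel_const nonneg_fm) \<longleftrightarrow> 0 \<le> x" for x :: int
    using sat_rel_const[of "[x]" nonneg_fm] wf_nonneg by (simp add: sat_nonneg)
  have ev: "sat class_ring [[:a:], [:b:], [:d:], [:n:], [:v:]] (rel_const eval_fm) \<longleftrightarrow>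
      poly (coded_poly a b d) n = v" if "0 \<le> b" "0 \<le> d" for a b d n v :: int
    using sat_rel_const[of "[a, b, d, n, v]" eval_fm] wf_eval that
    by (simp add: sat_eval eval_nat_numeral)
  have inst_nn: "sat class_ring e (inst (rel_const nonneg_fm) [i]) \<longleftrightarrow> sat class_ring [e ! i] (rel_const nonneg_fm)"
    for e :: "int poly list" and i
    using wf_rel_const[OF wf_nonneg] by (simp add: sat_inst)
  have inst_ev: "sat class_ring e (inst (rel_const eval_fm) [2, 3, 4, Suc 0, 0]) \<longleftrightarrow>
      sat class_ring [e ! 2, e ! 3, e ! 4, e ! Suc 0, e ! 0] (rel_const eval_fm)" for e :: "int poly list"
    by (subst sat_inst) (use wf_rel_const[OF wf_eval] in \<open>simp_all add: eval_nat_numeral\<close>)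
  have all_const: "(\<forall>a a'. (\<exists>k. a = [:k:]) \<and> (\<exists>k. a' = [:k:]) \<and> P a a' \<longrightarrow> Q a a') \<longleftrightarrow>
      (\<forall>n v. P [:n:] [:v:] \<longrightarrow> Q [:n:] [:v:])" for P Q :: "int poly \<Rightarrow> int poly \<Rightarrow> bool"
    by blast
  show ?thesis
    unfolding eq_pcompose_linear_iff[OF assms]
    by (auto simp: poly_map_fm_def sat_conjs inst_nn inst_ev all_const nn ev)
qed

definition const_map_fm :: fm where
  "const_map_fm = conjs [inst nonneg_fm [1], inst nonneg_fm [2], Forall (inst eval_fm [1, 2, 3, 0, 4])]"

lemma wf_const_map: "wf_fm 7 const_map_fm"
  by (simp add: const_map_fm_def)

lemma sat_const_map:
  "sat class_ring [a, b, d, x, r0, r1, r2] const_map_fm \<longleftrightarrow> 0 \<le> b \<and> 0 \<le> d \<and> coded_poly a b d = [:x:]"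
proof -
  have "coded_poly a b d = [:x:] \<longleftrightarrow> (\<forall>n. poly (coded_poly a b d) n = x)"
    unfolding poly_eq_poly_eq_iff[symmetric] fun_eq_iff by simp
  then show ?thesis by (auto simp: const_map_fm_def sat_conjs)
qed

lemma solutions_true: "solutions class_ring 0 true_fm = {[]}"
  by (auto simp: solutions_def true_fm_def tuples_class_ring)

lemma coordinatization_poly_code':
  "p \<in> solutions class_ring (cpar poly_code) true_fm \<Longrightarrow>
    coordinatization poly_code (class_ring :: int ring) p class_ring poly_of_code"
  using coordinatization_poly_code by (simp add: solutions_true)

lemma coordinatization_int_code':
  "p \<in> solutions class_ring (cpar int_code) linear_fm \<Longrightarrow>
    coordinatization int_code class_ring p (class_ring :: int ring) int_of_code"
  using coordinatization_int_code by (auto simp: solutions_linear[unfolded One_nat_def])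

lemma regular_interpretation_poly_code:
  "regular_interpretation poly_code true_fm (class_ring :: int poly ring) (class_ring :: int ring)"
proof (rule regular_interpretationI)
  show "wf_fm (cpar poly_code) true_fm" by (simp add: true_fm_def)
qed (use wf_poly_code coordinatization_poly_code' in \<open>auto simp: solutions_true\<close>)

lemma regular_interpretation_int_code:
  "regular_interpretation int_code linear_fm (class_ring :: int ring) (class_ring :: int poly ring)"
proof (rule regular_interpretationI)
  \<comment> \<open>The indeterminate itself is an admissible parameter.\<close>
  have "[[:0, 1:]] \<in> (solutions class_ring 1 linear_fm :: int poly list set)"
    unfolding solutions_linear by (intro CollectI exI[of _ 0] exI[of _ 1]) simp
  then show "solutions class_ring (cpar int_code) linear_fm \<noteq> ({} :: int poly list set)"
    by (simp only: int_code_dims) blast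
qed (use wf_int_code wf_linear coordinatization_int_code' in auto)

text \<open>The composite of the given coordinate maps returns the coded polynomial itself.
  Following it by the automorphism that substitutes \<open>t\<close> gives the coordinate map
  defined by \<open>poly_map_fm\<close>.\<close>

lemma coordinate_maps_poly:
  "defines_coordinate_maps poly_map_fm (comp_code poly_code int_code)
     (comp_adm poly_code true_fm int_code linear_fm) (class_ring :: int poly ring)"
proof -
  have dims: "cdim (comp_code poly_code int_code) = 3" "cpar (comp_code poly_code int_code) = 1"
    by (simp_all add: comp_code_def)
  have "\<exists>\<mu>. coordinate_map (comp_code poly_code int_code) class_ring r class_ring \<mu> \<and>
      (\<forall>u\<in>tuples class_ring 3. \<forall>x\<in>carrier class_ring.
         sat class_ring (u @ [x] @ r) poly_map_fm \<longleftrightarrow>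
         u \<in> dom_set (comp_code poly_code int_code) class_ring r \<and> x = \<mu> u)"
    if r: "r \<in> solutions class_ring (cpar (comp_code poly_code int_code))
      (comp_adm poly_code true_fm int_code linear_fm)" for r :: "int poly list"
  proof -
    note adm = solutions_comp_adm[OF wf_int_code _ _ coordinatization_int_code' r, simplified]
    have "r \<in> solutions class_ring 1 linear_fm"
      using adm(2) wf_linear by (simp add: true_fm_def)
    then obtain k s where rt: "r = [[:k, s:]]" and s: "s * s = 1" unfolding solutions_linear by blast
    define \<mu> where "\<mu> w = poly_of_code (decode 1 int_of_code 3 w)" for w
    \<comment> \<open>As \<open>poly_code\<close> has no parameters, \<open>r\<close> consists of
      the parameter of \<open>int_code\<close> alone.\<close>
    have dec0: "decode (cdim int_code) int_of_code (cpar poly_code) r = []" by (simp add: decode_def)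
    have comp: "coordinatization (comp_code poly_code int_code) class_ring r class_ring \<mu>"
      "dom_set (comp_code poly_code int_code) class_ring r = {w \<in> tuples class_ring 3.
        (\<forall>j<3. blk 1 w j \<in> dom_set int_code class_ring r) \<and>
        decode 1 int_of_code 3 w \<in> dom_set poly_code class_ring []}"
      using coordinatization_comp[OF wf_poly_code wf_int_code, of class_ring r class_ring int_of_code
          class_ring poly_of_code] coordinatization_int_code coordinatization_poly_code
      by (simp_all add: dec0 rt \<mu>_def[abs_def] decode_def[of _ _ 0])
    have hom: "coordinatization (comp_code poly_code int_code) class_ring r class_ring
        (\<lambda>w. pcompose (\<mu> w) [:k, s:])"
    proof (rule coordinatization_hom[OF comp(1) closed_struct_class_ring])
      show "bij_betw (\<lambda>f. pcompose f [:k, s:]) (carrier class_ring) (carrier class_ring)"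
        using bij_pcompose_linear[OF s] by simp
    qed (simp_all add: pcompose_add pcompose_mult pcompose_1)
    have "sat class_ring (u @ [x] @ r) poly_map_fm \<longleftrightarrow>
         u \<in> dom_set (comp_code poly_code int_code) class_ring r \<and> x = pcompose (\<mu> u) [:k, s:]"
      if u: "u \<in> tuples class_ring 3" for u x
    proof -
      obtain u0 u1 u2 where u: "u = [u0, u1, u2]"
        using u by (auto simp: tuples_class_ring numeral_3_eq_3 length_Suc_conv)
      have all3: "(\<forall>j<3. Q j) \<longleftrightarrow> Q 0 \<and> Q 1 \<and> Q 2" for Q :: "nat \<Rightarrow> bool"
        by (auto simp: less_Suc_eq numeral_3_eq_3 numeral_2_eq_2)
      have dec: "decode (Suc 0) int_of_code 3 [f0, f1, f2] = [coeff f0 0, coeff f1 0, coeff f2 0]" for f0 f1 f2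
        by (simp add: decode_def upt_rec blk_one int_of_code_def)
      show ?thesis
        unfolding comp(2) \<mu>_def
        by (auto simp: all3 dec blk_one dom_set_int_code dom_set_poly_code rt u sat_poly_map[OF s]
            poly_of_code_def tuples_class_ring)
    qed
    then show ?thesis
      using coordinatization_imp_coordinate_map[OF hom] by blast
  qed
  then show ?thesis
    unfolding defines_coordinate_maps_def using wf_poly_map by (simp add: dims)
qed

text \<open>A triple in the composite domain codes a constant polynomial and is sent to that
  constant, which \<open>const_map_fm\<close> recognises as the common value at all
  integers.\<close>

lemma coordinate_maps_int:
  "defines_coordinate_maps const_map_fm (comp_code int_code poly_code)
     (comp_adm int_code linear_fm poly_code true_fm) (class_ring :: int ring)"
proof -
  have dims: "cdim (comp_code int_code poly_code) = 3" "cpar (comp_code int_code poly_code) = 3"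
    by (simp_all add: comp_code_def)
  have "\<exists>\<mu>. coordinate_map (comp_code int_code poly_code) class_ring r class_ring \<mu> \<and>
      (\<forall>u\<in>tuples class_ring 3. \<forall>x\<in>carrier class_ring.
         sat class_ring (u @ [x] @ r) const_map_fm \<longleftrightarrow>
         u \<in> dom_set (comp_code int_code poly_code) class_ring r \<and> x = \<mu> u)"
    if r: "r \<in> solutions class_ring (cpar (comp_code int_code poly_code))
      (comp_adm int_code linear_fm poly_code true_fm)" for r :: "int list"
  proof -
    note adm = solutions_comp_adm[OF wf_poly_code _ _ coordinatization_poly_code' r]
    have lr: "length r = 3" using adm(1) wf_linear by (simp add: true_fm_def)
    have rdom: "blk 3 r 0 \<in> dom_set poly_code class_ring []"
      using adm(3) wf_linear lr by (simp add: true_fm_def)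
    \<comment> \<open>The three parameters form the code of one polynomial, the parameter of
      \<open>int_code\<close>.\<close>
    obtain t where t: "decode 3 poly_of_code 1 r = [t]"
      by (simp add: decode_def)
    define \<mu> where "\<mu> w = int_of_code (decode 3 poly_of_code 1 w)" for w
    have comp: "coordinatization (comp_code int_code poly_code) class_ring r class_ring \<mu>"
      "dom_set (comp_code int_code poly_code) class_ring r = {w \<in> tuples class_ring 3.
        blk 3 w 0 \<in> dom_set poly_code class_ring [] \<and>
        decode 3 poly_of_code 1 w \<in> dom_set int_code class_ring [t]}"
      using coordinatization_comp[OF wf_int_code wf_poly_code, of class_ring r class_ring poly_of_code
          class_ring int_of_code] coordinatization_int_code coordinatization_poly_code t lr rdom
      by (simp_all add: \<mu>_def[abs_def])
    have "sat class_ring (u @ [x] @ r) const_map_fm \<longleftrightarrow>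
         u \<in> dom_set (comp_code int_code poly_code) class_ring r \<and> x = \<mu> u"
      if u: "u \<in> tuples class_ring 3" for u x
    proof -
      obtain a b d where u: "u = [a, b, d]"
        using u by (auto simp: tuples_class_ring numeral_3_eq_3 length_Suc_conv)
      obtain r0 r1 r2 where r: "r = [r0, r1, r2]"
        using lr by (auto simp: numeral_3_eq_3 length_Suc_conv)
      have bu: "blk 3 [a, b, d] 0 = [a, b, d]" by (rule blk_0) simp
      then have "decode 3 poly_of_code (Suc 0) [a, b, d] = [coded_poly a b d]"
        by (simp add: decode_def poly_of_code_def)
      then show ?thesis
        unfolding comp(2) \<mu>_def u
        by (auto simp: bu dom_set_int_code dom_set_poly_code r sat_const_map int_of_code_def
            tuples_class_ring)
    qed
    then show ?thesis
      using coordinatization_imp_coordinate_map[OF comp(1)] by blast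
  qed
  then show ?thesis
    unfolding defines_coordinate_maps_def using wf_const_map by (simp add: dims)
qed

theorem theorem6p1:
  shows "regularly_bi_interpretable (class_ring :: int poly ring) (class_ring :: int ring)"
  unfolding regularly_bi_interpretable_def
  using regular_interpretation_poly_code regular_interpretation_int_code
    coordinate_maps_poly coordinate_maps_int by blast

end
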